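(* Let $A$ be a Banach algebra with a right identity $u$, let $B$ be a semisimple Banach algebra, and let $\theta,\phi,\gamma,\eta_1,\eta_2$ be nonzero multiplicative linear functionals on $B$. If $\theta\neq\phi$, then the only $(\eta_1,\eta_2)$-centralizing element of $\mathrm{Der}_J(A\times_\theta^{\phi,\gamma}B)$ is the zero map.
   Context: Banach algebras are over $\mathbb{C}$. A right identity of $A$ is an element $u\in A$ with $au=a$ for all $a\in A$. For a multiplicative linear functional $\eta$ on $B$, the $\eta$-Lau product on the vector space $A\times B$ is $$(a,b)\cdot_\eta(x,y)=(ax+\eta(y)a+\eta(b)x,\ by).$$ For nonzero multiplicative linear functionals $\theta,\phi,\gamma$ on $B$, $\mathrm{Der}_J(A\times_\theta^{\phi,\gamma}B)$ denotes the set of all linear maps $d:A\times B\to A\times B$ (no continuity assumed) satisfying $$d((a,b)\cdot_\theta(a,b))=d(a,b)\cdot_\phi(a,b)+(a,b)\cdot_\gamma d(a,b)\qquad(a\in A,\ b\in B).$$ An element $d\in\mathrm{Der}_J(A\times_\theta^{\phi,\gamma}B)$ is called $(\eta_1,\eta_2)$-centralizing if for all $a\in A$ and $b\in B$, $$d(a,b)\cdot_{\eta_1}(a,b)-(a,b)\cdot_{\eta_2}d(a,b)\in \mathrm{Z}(A)\times\mathrm{Z}(B),$$ where $\mathrm{Z}(\cdot)$ denotes the center of an algebra. *)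

theory Defs
  imports "HOL-Analysis.Analysis"
begin

class complex_vector = ab_group_add +
  fixes scaleC :: "complex \<Rightarrow> 'a \<Rightarrow> 'a"  (infixr \<open>*\<^sub>C\<close> 75)
  assumes scaleC_add_right: "c *\<^sub>C (x + y) = c *\<^sub>C x + c *\<^sub>C y"
    and scaleC_add_left: "(c + d) *\<^sub>C x = c *\<^sub>C x + d *\<^sub>C x"
    and scaleC_scaleC: "c *\<^sub>C d *\<^sub>C x = (c * d) *\<^sub>C x"
    and scaleC_one: "1 *\<^sub>C x = x"

global_interpretation complex_vector: vector_space "scaleC :: complex \<Rightarrow> 'a \<Rightarrow> 'a::complex_vector"
  by unfold_locales (rule scaleC_add_right scaleC_add_left scaleC_scaleC scaleC_one)+

text \<open>Complex Banach algebras, not assumed unital or commutative. The real structure of the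
  library classes is the restriction of the complex one to real scalars.\<close>

class complex_banach_algebra = complex_vector + real_normed_algebra + banach +
  assumes scaleR_scaleC: "r *\<^sub>R x = complex_of_real r *\<^sub>C x"
    and norm_scaleC: "norm (c *\<^sub>C x) = cmod c * norm x"
    and scaleC_mult_left: "(c *\<^sub>C x) * y = c *\<^sub>C (x * y)"
    and scaleC_mult_right: "x * (c *\<^sub>C y) = c *\<^sub>C (x * y)"

instantiation complex :: complex_banach_algebra
begin
definition scaleC_complex :: "complex \<Rightarrow> complex \<Rightarrow> complex" where
  "scaleC_complex c x = c * x"
instance
  by standard (auto simp: scaleC_complex_def algebra_simps norm_mult scaleR_conv_of_real)
end

instantiation prod :: (complex_vector, complex_vector) complex_vector
begin
definition scaleC_prod :: "complex \<Rightarrow> 'a \<times> 'b \<Rightarrow> 'a \<times> 'b" where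
  "scaleC_prod c p = (c *\<^sub>C fst p, c *\<^sub>C snd p)"
instance
  by standard (auto simp: scaleC_prod_def scaleC_add_right scaleC_add_left scaleC_scaleC scaleC_one
    prod_eq_iff)
end

abbreviation clinear :: "('a::complex_vector \<Rightarrow> 'b::complex_vector) \<Rightarrow> bool" where
  "clinear \<equiv> Vector_Spaces.linear scaleC scaleC"

definition mult_linear_functional :: "('b::complex_banach_algebra \<Rightarrow> complex) \<Rightarrow> bool" where
  "mult_linear_functional \<eta> \<longleftrightarrow> clinear \<eta> \<and> (\<forall>x y. \<eta> (x * y) = \<eta> x * \<eta> y)"

definition nonzero_mult_linear_functional :: "('b::complex_banach_algebra \<Rightarrow> complex) \<Rightarrow> bool" where
  "nonzero_mult_linear_functional \<eta> \<longleftrightarrow> mult_linear_functional \<eta> \<and> \<eta> \<noteq> (\<lambda>_. 0)"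

definition left_ideal :: "'a::complex_banach_algebra set \<Rightarrow> bool" where
  "left_ideal I \<longleftrightarrow> complex_vector.subspace I \<and> (\<forall>x. \<forall>y\<in>I. x * y \<in> I)"

definition modular_left_ideal :: "'a::complex_banach_algebra set \<Rightarrow> bool" where
  "modular_left_ideal I \<longleftrightarrow> left_ideal I \<and> (\<exists>e. \<forall>x. x - x * e \<in> I)"

definition maximal_modular_left_ideal :: "'a::complex_banach_algebra set \<Rightarrow> bool" where
  "maximal_modular_left_ideal M \<longleftrightarrow> modular_left_ideal M \<and> M \<noteq> UNIV \<and>
     (\<forall>J. left_ideal J \<and> M \<subseteq> J \<longrightarrow> J = M \<or> J = UNIV)"

text \<open>The empty intersection is \<^term>\<open>UNIV\<close>, so an algebra without maximal modular left
  ideals is its own radical, as usual.\<close>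

definition jacobson_radical :: "'a::complex_banach_algebra set" where
  "jacobson_radical = \<Inter> {M. maximal_modular_left_ideal M}"

definition semisimple :: "'a::complex_banach_algebra itself \<Rightarrow> bool" where
  "semisimple _ \<longleftrightarrow> (jacobson_radical :: 'a set) = {0}"

definition algebra_center :: "'a::complex_banach_algebra set" where
  "algebra_center = {z. \<forall>x. z * x = x * z}"

definition lau_mult ::
  "('b \<Rightarrow> complex) \<Rightarrow> 'a::complex_banach_algebra \<times> 'b::complex_banach_algebra \<Rightarrow> 'a \<times> 'b \<Rightarrow> 'a \<times> 'b" where
  "lau_mult \<eta> = (\<lambda>(a, b) (x, y). (a * x + \<eta> y *\<^sub>C a + \<eta> b *\<^sub>C x, b * y))"

definition DerJ ::
  "('b \<Rightarrow> complex) \<Rightarrow> ('b \<Rightarrow> complex) \<Rightarrow> ('b \<Rightarrow> complex) \<Rightarrow>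
   ('a::complex_banach_algebra \<times> 'b::complex_banach_algebra \<Rightarrow> 'a \<times> 'b) set" where
  "DerJ \<theta> \<phi> \<gamma> = {d. clinear d \<and>
     (\<forall>a b. d (lau_mult \<theta> (a, b) (a, b)) =
        lau_mult \<phi> (d (a, b)) (a, b) + lau_mult \<gamma> (a, b) (d (a, b)))}"

definition centralizing ::
  "('b \<Rightarrow> complex) \<Rightarrow> ('b \<Rightarrow> complex) \<Rightarrow>
   ('a::complex_banach_algebra \<times> 'b::complex_banach_algebra \<Rightarrow> 'a \<times> 'b) \<Rightarrow> bool" where
  "centralizing \<eta>1 \<eta>2 d \<longleftrightarrow>
     (\<forall>a b. lau_mult \<eta>1 (d (a, b)) (a, b) - lau_mult \<eta>2 (a, b) (d (a, b))
        \<in> algebra_center \<times> algebra_center)"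

end

theory Submission imports Defs begin

text \<open>
  Write \<open>d (a, b) = (S a + T b, P a + Q b)\<close>. The map \<open>Q\<close> is a centralizing Jordan derivation of \<open>B\<close>,
  and the heart of the matter is that \<open>Q = 0\<close>. Since \<open>B\<close> is semiprime, \<open>Q\<close> is a derivation
  (Bresar), and being centralizing it has central values. Modulo a
  maximal modular left ideal a central element acts as a scalar (Schur and Gelfand--Mazur), so the
  characters of the centre separate its points, and Johnson's theorem (a derivation of a
  commutative semisimple Banach algebra is zero, without continuity assumption) kills \<open>Q\<close> on the
  centre. Hence \<open>Q (Q x) = 0\<close>, so \<open>Q x\<close> is central with square zero. The values of \<open>P\<close>, \<open>S\<close> and \<open>T\<close> are
  then computed with the right identity \<open>u\<close>; only the vanishing of \<open>S\<close> needs \<open>\<theta> \<noteq> \<phi>\<close>, through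
  \<open>2 \<theta> \<noteq> \<phi> + \<gamma>\<close>.
\<close>

section \<open>Jordan derivations of semiprime rings\<close>

text \<open>Two obstacles shape the argument: \<open>d\<close> is not assumed continuous, and
  \<open>B\<close> is not assumed commutative, so neither boundedness of \<open>Q\<close> nor
  characters of \<open>B\<close> are available at the start. The ring identities supply
  commutativity: they need only that 2 can be cancelled and that \<open>c B c = 0\<close> forces
  \<open>c = 0\<close>, and they push the range of \<open>Q\<close> into the centre. Characters of
  the centre are then manufactured from the simple modules \<open>B / M\<close>. These quotients are
  never built: distance to \<open>M\<close> serves as their norm, and averaging over roots of unity
  replaces complex integration. On the centre, continuity of the derivation is itself a theorem:
  only finitely many characters can have an unbounded composition with it, and the others already
  separate points. What makes \<theta> \<noteq> \<phi> sufficient at the end is multiplicativity: 2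
  \<theta> = \<phi> + \<gamma>, evaluated at squares, forces \<phi> = \<gamma>.\<close>

definition commutator :: "'a::ring \<Rightarrow> 'a \<Rightarrow> 'a" where
  "commutator x y = x * y - y * x"

text \<open>Turning \<open>b * t * a\<close> into \<open>a * t * b\<close> costs a sign. Three such
  moves carry \<open>(a * x * b) * y * (a * x * b)\<close> to its own negative, so it vanishes by
  2-torsion freeness.\<close>

lemma bresar_semiprime:
  fixes a b :: "'a::ring"
  assumes tf: "\<And>x::'a. x + x = 0 \<Longrightarrow> x = 0"
    and sp: "\<And>c::'a. (\<And>x. c * x * c = 0) \<Longrightarrow> c = 0"
    and ab: "\<And>x. a * x * b + b * x * a = 0"
  shows "a * x * b = 0"
proof (rule sp)
  fix y
  have sw: "b * t * a = - (a * t * b)" for t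
    using ab[of t] by (simp add: eq_neg_iff_add_eq_0 add.commute)
  have "(a * x * b) * y * (a * x * b) = a * x * (b * y * a) * x * b"
    by (simp add: mult.assoc)
  also have "\<dots> = - (a * (x * a * y) * b) * x * b"
    by (simp only: sw) (simp add: mult.assoc)
  also have "\<dots> = (b * (x * a * y) * a) * x * b"
    by (simp only: sw)
  also have "\<dots> = (b * x * a) * y * (a * x * b)"
    by (simp add: mult.assoc)
  also have "\<dots> = - ((a * x * b) * y * (a * x * b))"
    by (simp only: sw) (simp add: mult.assoc)
  finally show "(a * x * b) * y * (a * x * b) = 0"
    using tf by (metis add.right_inverse)
qed

locale jordan_derivation =
  fixes D :: "'a::ring \<Rightarrow> 'a"
  assumes tf: "\<And>x::'a. x + x = 0 \<Longrightarrow> x = 0"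
    and sp: "\<And>c::'a. (\<And>x. c * x * c = 0) \<Longrightarrow> c = 0"
    and add: "D (x + y) = D x + D y"
    and sq: "D (x * x) = D x * x + x * D x"
begin

lemma D_zero: "D 0 = 0"
  using add[of 0 0] by simp

lemma D_minus: "D (- x) = - D x"
  using add[of x "- x"] D_zero by (simp add: eq_neg_iff_add_eq_0 add.commute)

lemma D_diff: "D (x - y) = D x - D y"
  using add[of x "- y"] D_minus by simp

lemma double_cancel: "x + x = y + y \<Longrightarrow> x = (y::'a)"
  using tf[of "x - y"] by (simp add: algebra_simps)

lemma jordan: "D (x * y + y * x) = D x * y + x * D y + D y * x + y * D x"
proof -
  have "D ((x + y) * (x + y)) = D (x + y) * (x + y) + (x + y) * D (x + y)"
    by (rule sq)
  moreover have "(x + y) * (x + y) = x * x + (x * y + y * x) + y * y"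
    by (simp add: algebra_simps)
  ultimately show ?thesis
    by (simp add: add sq algebra_simps)
qed

text \<open>Twice \<open>x * y * x\<close> is a combination of nested Jordan products, so the
  formula follows after cancelling 2.\<close>

lemma triple: "D (x * y * x) = D x * y * x + x * D y * x + x * y * D x"
proof (rule double_cancel)
  have "x * y * x + x * y * x =
      (x * (x * y + y * x) + (x * y + y * x) * x) - ((x * x) * y + y * (x * x))"
    by (simp add: algebra_simps)
  then have "D (x * y * x) + D (x * y * x) = 
     D (x * (x * y + y * x) + (x * y + y * x) * x) - D ((x * x) * y + y * (x * x))"
    by (metis add D_diff)
  then show "D (x * y * x) + D (x * y * x) = 
    D x * y * x + x * D y * x + x * y * D x + (D x * y * x + x * D y * x + x * y * D x)"
    unfolding jordan sq by (simp add: algebra_simps)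
qed

lemma triple_linear:
  "D (x * y * z + z * y * x) =
     D x * y * z + x * D y * z + x * y * D z + D z * y * x + z * D y * x + z * y * D x"
proof -
  have "D ((x + z) * y * (x + z)) =
      D (x + z) * y * (x + z) + (x + z) * D y * (x + z) + (x + z) * y * D (x + z)"
    by (rule triple)
  moreover have "D ((x + z) * y * (x + z)) =
      D (x * y * x) + D (x * y * z + z * y * x) + D (z * y * z)"
    by (simp add: distrib_left distrib_right add ac_simps(1,3))
  ultimately have "D (x * y * x) + D (x * y * z + z * y * x) + D (z * y * z) =
      D (x + z) * y * (x + z) + (x + z) * D y * (x + z) + (x + z) * y * D (x + z)"
    by simp
  then show ?thesis
    unfolding triple add by (simp add: algebra_simps)
qed

text \<open>The obstruction to the Leibniz rule. It is biadditive, and the Jordan identity makes it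
  antisymmetric, which is the content of \<open>D_mult_swap\<close>.\<close>

definition defect :: "'a \<Rightarrow> 'a \<Rightarrow> 'a" where
  "defect x y = D (x * y) - D x * y - x * D y"

lemma defect_add_left: "defect (x + y) z = defect x z + defect y z"
  by (simp add: defect_def add algebra_simps)

lemma defect_add_right: "defect z (x + y) = defect z x + defect z y"
  by (simp add: defect_def add algebra_simps)

lemma D_mult: "D (x * y) = defect x y + D x * y + x * D y"
  by (simp add: defect_def)

lemma D_mult_swap: "D (y * x) = D y * x + y * D x - defect x y"
  using jordan[of x y] by (simp add: add defect_def algebra_simps)

text \<open>One element is differentiated in two ways: as the nested triple products
  \<open>x (y z y) x + y (x z x) y\<close>, and as a linearised triple product of
  \<open>x * y\<close> and \<open>y * x\<close>. Only defects times commutators survive the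
  comparison.\<close>

lemma defect_commutator_swap:
  "defect x y * z * commutator x y + commutator x y * z * defect x y = 0"
proof -
  have "x * (y * z * y) * x + y * (x * z * x) * y = (x * y) * z * (y * x) + (y * x) * z * (x * y)"
    by (simp add: mult.assoc)
  then have "D (x * (y * z * y) * x) + D (y * (x * z * x) * y) =
      D ((x * y) * z * (y * x) + (y * x) * z * (x * y))"
    by (metis add)
  then have "D (x * (y * z * y) * x) + D (y * (x * z * x) * y) -
      D ((x * y) * z * (y * x) + (y * x) * z * (x * y)) = 0" by simp
  then show ?thesis
    unfolding triple triple_linear D_mult[of x y] D_mult_swap[of y x] commutator_def
    by (simp add: algebra_simps)
qed

lemma defect_commutator: "defect x y * z * commutator x y = 0"
  by (rule bresar_semiprime[OF tf sp defect_commutator_swap])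

lemma commutator_add_left: "commutator (x + y) z = commutator x z + commutator y (z::'a)"
  and commutator_add_right: "commutator z (x + y) = commutator z x + commutator z (y::'a)"
  by (simp_all add: commutator_def algebra_simps)

text \<open>Polarising in \<open>y\<close> exchanges \<open>y\<close> and \<open>v\<close> at the
  cost of a sign. Done only in the last factor of \<open>c * t * c\<close>, this brings
  \<open>defect x y\<close> and \<open>commutator x y\<close> into one product, which is zero. The
  next lemma frees the first argument in the same way.\<close>

lemma defect_commutator_right: "defect x y * z * commutator x v = 0"
proof (rule sp)
  fix t
  have lin: "defect x y * z * commutator x v = - (defect x v * z * commutator x y)" for z
    using defect_commutator[of x "y + v" z] defect_commutator[of x y z] defect_commutator[of x v z]
    by (simp add: defect_add_right commutator_add_right distrib_left distrib_right eq_neg_iff_add_eq_0 add.commute)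
  have "(defect x y * z * commutator x v) * t * (defect x y * z * commutator x v) =
     - (defect x y * (z * commutator x v * t * defect x v * z) * commutator x y)"
    by (subst (2) lin) (simp add: mult.assoc)
  then show "(defect x y * z * commutator x v) * t * (defect x y * z * commutator x v) = 0"
    by (simp add: defect_commutator)
qed

lemma defect_commutator_all: "defect x y * z * commutator u v = 0"
proof (rule sp)
  fix t
  have lin: "defect x y * z * commutator u v = - (defect u y * z * commutator x v)" for z
    using defect_commutator_right[of "x + u" y z v] defect_commutator_right[of x y z v]
      defect_commutator_right[of u y z v]
    by (simp add: defect_add_left commutator_add_left distrib_left distrib_right eq_neg_iff_add_eq_0 add.commute)
  have "(defect x y * z * commutator u v) * t * (defect x y * z * commutator u v) =
     - (defect x y * (z * commutator u v * t * defect u y * z) * commutator x v)"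
    by (subst (2) lin) (simp add: mult.assoc)
  then show "(defect x y * z * commutator u v) * t * (defect x y * z * commutator u v) = 0"
    by (simp add: defect_commutator_right)
qed

text \<open>Sandwiching the commutator of the defect with \<open>u\<close> and expanding its first
  occurrence leaves only products of a defect with a later commutator.\<close>

lemma defect_central: "defect x y * u = u * defect x y"
proof -
  have "commutator (defect x y) u = 0"
  proof (rule sp)
    fix z
    have "commutator (defect x y) u * z * commutator (defect x y) u =
      defect x y * (u * z) * commutator (defect x y) u -
      u * (defect x y * z * commutator (defect x y) u)"
      by (simp add: commutator_def[of "defect x y" u] algebra_simps)
    then show "commutator (defect x y) u * z * commutator (defect x y) u = 0"
      by (simp only: defect_commutator_all) simp
  qed
  then show ?thesis by (simp add: commutator_def)
qed

lemma central_square_zero: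
  assumes "\<And>x. c * x = x * c" "c * c = (0::'a)" shows "c = 0"
proof (rule sp)
  fix x
  have "c * x * c = x * (c * c)" by (simp add: assms(1)[of x] mult.assoc)
  then show "c * x * c = 0" by (simp add: assms(2))
qed

lemma defect_mult_commutator: "defect x y * commutator u v = 0"
proof (rule sp)
  fix t
  have "(defect x y * commutator u v) * t * (defect x y * commutator u v) =
      defect x y * (commutator u v * t * defect x y) * commutator u v"
    by (simp add: mult.assoc)
  then show "(defect x y * commutator u v) * t * (defect x y * commutator u v) = 0"
    by (simp only: defect_commutator_all)
qed

text \<open>With \<open>G\<close> the defect and \<open>c\<close> the commutator of \<open>x\<close>
  and \<open>y\<close>, differentiating \<open>G * c + c * G = 0\<close> and multiplying by
  \<open>G\<close> leaves \<open>G * G * D c = 0\<close>. Since \<open>D c\<close> is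
  \<open>G + G\<close> plus commutators killed by \<open>G\<close>, the cube of the central element
  \<open>G\<close> vanishes.\<close>

theorem derivation: "D (x * y) = D x * y + x * D y"
proof -
  define G where "G = defect x y"
  define c where "c = commutator x y"
  have cen: "G * u = u * G" for u by (simp add: G_def defect_central)
  have Gc: "G * commutator u v = 0" for u v by (simp add: G_def defect_mult_commutator)
  have "D (G * c + c * G) = 0"
    using cen[of c] Gc[of x y] D_zero by (simp add: c_def)
  then have *: "D G * c + G * D c + D c * G + c * D G = 0"
    by (simp add: jordan)
  have z1: "G * (D G * c) = 0" "G * (c * D G) = 0"
  proof -
    have "G * (D G * c) = D G * (G * c)" by (metis cen mult.assoc)
    then show "G * (D G * c) = 0" by (simp add: Gc c_def)
    have "G * (c * D G) = (G * c) * D G" by (simp add: mult.assoc)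
    then show "G * (c * D G) = 0" by (simp add: Gc c_def)
  qed
  have "G * (D G * c + G * D c + D c * G + c * D G) = 0" using * by simp
  then have "G * (G * D c) + G * (G * D c) = 0"
    using z1 cen[of "D c"] by (simp add: distrib_left)
  then have GGDc: "G * G * D c = 0" using tf[of "G * G * D c"] by (simp add: mult.assoc)
  have "D c = D (x * y) - D (y * x)" by (simp add: c_def commutator_def D_diff)
  then have "G + G = D c - commutator (D x) y - commutator x (D y)"
    unfolding D_mult_swap[of y x] D_mult[of x y] G_def commutator_def by (simp add: algebra_simps)
  then have "G * (G + G) = G * (D c - commutator (D x) y - commutator x (D y))"
    by simp
  then have "G * (G + G) = G * D c" by (simp add: right_diff_distrib Gc)
  then have "G * (G * (G + G)) = 0" using GGDc by (simp add: mult.assoc)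
  then have "G * (G * G) = 0" using tf[of "G * (G * G)"] by (simp add: distrib_left)
  then have "(G * G) * (G * G) = 0" by (simp add: mult.assoc)
  moreover have "(G * G) * u = u * (G * G)" for u by (metis cen mult.assoc)
  ultimately have "G * G = 0" using central_square_zero[of "G * G"] by blast
  then have "G = 0" using central_square_zero[of G] cen by blast
  then show ?thesis using D_mult[of x y] by (simp add: G_def)
qed

text \<open>Polarising the hypothesis at \<open>x\<close> and \<open>x * x\<close> makes
  \<open>t\<close>, four times \<open>x * c\<close>, central. Commuting \<open>t\<close> with
  \<open>D x\<close> yields four times \<open>c * c\<close> up to sign, so the central element
  \<open>c\<close> has square zero.\<close>

lemma centralizing_imp_commuting:
  assumes cen: "\<And>x u. commutator (D x) x * u = u * commutator (D x) x"
  shows "commutator (D x) x = 0"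
proof -
  define c where "c = commutator (D x) x"
  have cc: "c * u = u * c" for u by (simp add: c_def cen)
  define t where "t = commutator (D x) (x * x) + commutator (D (x * x)) x"
  have "t = commutator (D (x + x * x)) (x + x * x) - commutator (D x) x
      - commutator (D (x * x)) (x * x)"
    unfolding add by (simp add: t_def commutator_add_left commutator_add_right)
  then have tu: "t * u = u * t" for u
    by (simp only: left_diff_distrib right_diff_distrib cen)
  have "t = (c * x + x * c) + (c * x + x * c)"
    unfolding t_def sq by (simp add: c_def commutator_def algebra_simps)
  then have t: "t = (x * c + x * c) + (x * c + x * c)" by (simp add: cc[of x])
  have "x * c * D x - D x * (x * c) = - (c * c)"
  proof -
    have "x * c * D x - D x * (x * c) = x * (c * D x) - D x * x * c" by (simp add: mult.assoc)
    also have "\<dots> = (x * D x - D x * x) * c"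
      by (simp add: cc[of "D x"] left_diff_distrib mult.assoc)
    also have "x * D x - D x * x = - c" by (simp add: c_def commutator_def)
    finally have "x * c * D x - D x * (x * c) = - c * c" .
    then show ?thesis by simp
  qed
  note key = this
  have "t * D x - D x * t = ((x * c * D x - D x * (x * c)) + (x * c * D x - D x * (x * c)))
     + ((x * c * D x - D x * (x * c)) + (x * c * D x - D x * (x * c)))"
    by (simp add: t algebra_simps)
  then have "(- (c * c) + - (c * c)) + (- (c * c) + - (c * c)) = 0"
    unfolding key by (simp add: tu)
  from tf[OF tf[OF this]] have "c * c = 0" by simp
  then have "c = 0" using central_square_zero[of c] cc by blast
  then show ?thesis by (simp add: c_def)
qed

text \<open>Posner's substitutions: in \<open>commutator (D x) y = commutator x (D y)\<close>,
  replacing \<open>y\<close> by \<open>y * x\<close> isolates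
  \<open>commutator x y * D x = 0\<close>. A middle factor and an independent argument of
  \<open>D\<close> are then inserted, until \<open>commutator (D x) z\<close> can be
  sandwiched.\<close>

theorem centralizing_imp_central_range:
  assumes cen: "\<And>x u. commutator (D x) x * u = u * commutator (D x) x"
  shows "D x * z = z * D x"
proof -
  have lin: "commutator (D x) y = commutator x (D y)" for x y
    using centralizing_imp_commuting[OF cen, of "x + y"] centralizing_imp_commuting[OF cen, of x]
      centralizing_imp_commuting[OF cen, of y]
    by (simp add: add commutator_add_left commutator_add_right) (simp add: commutator_def algebra_simps)
  have lin0: "D x * x = x * D x" for x
    using centralizing_imp_commuting[OF cen, of x] by (simp add: commutator_def)
  have 1: "commutator x y * D x = 0" for x y
  proof -
    have "commutator (D x) (y * x) = commutator (D x) y * x"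
      by (simp add: commutator_def algebra_simps lin0)
    moreover have "commutator x (D (y * x)) = commutator x (D y) * x + commutator x y * D x"
      unfolding derivation by (simp add: commutator_def algebra_simps lin0)
    ultimately show ?thesis using lin[of x "y * x"] lin[of x y] by simp
  qed
  have 2: "commutator x z * y * D x = 0" for x y z
  proof -
    have "commutator x (z * y) = commutator x z * y + z * commutator x y"
      by (simp add: commutator_def algebra_simps)
    then show ?thesis using 1[of x "z * y"] 1[of x y] by (simp add: distrib_right mult.assoc)
  qed
  have 3: "commutator x z * y * D w = 0" for x y z w
  proof (rule sp)
    fix t
    have swap: "commutator x z * y * D w = - (commutator w z * y * D x)"
      using 2[of "x + w" z y] 2[of x z y] 2[of w z y]
      by (simp add: add commutator_add_left distrib_left distrib_right eq_neg_iff_add_eq_0 add.commute)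
    have "(commutator x z * y * D w) * t * (commutator x z * y * D w) =
       - (commutator x z * (y * D w * t * commutator w z * y) * D x)"
      by (subst (2) swap) (simp add: mult.assoc)
    then show "(commutator x z * y * D w) * t * (commutator x z * y * D w) = 0"
      by (simp add: 2)
  qed
  have "commutator (D x) z = 0"
  proof (rule sp)
    fix y
    have "commutator (D x) z * y * commutator (D x) z =
        commutator (D x) z * y * D x * z - commutator (D x) z * (y * z) * D x"
      by (subst (2) commutator_def) (simp add: right_diff_distrib mult.assoc)
    then show "commutator (D x) z * y * commutator (D x) z = 0"
      by (simp only: 3) simp
  qed
  then show ?thesis by (simp add: commutator_def)
qed

end

section \<open>The Gelfand--Mazur argument\<close>

lemma sum_roots_of_unity_power:
  fixes n k :: nat
  assumes "0 < k" "k < n"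
  shows "(\<Sum>j<n. (cis (2 * pi / n) ^ j) ^ k) = 0"
proof -
  define \<omega> where "\<omega> = cis (2 * pi / n)"
  have n: "n > 0" using assms by simp
  have "\<omega> ^ n = 1" using n by (simp add: \<omega>_def Complex.DeMoivre)
  have "\<omega> ^ k \<noteq> 1"
  proof
    assume "\<omega> ^ k = 1"
    then have "cis (2 * pi * k / n) = 1" by (simp add: \<omega>_def Complex.DeMoivre mult_ac)
    then have "cos (2 * pi * k / n) = 1" by (metis cis.simps(1) one_complex.simps(1))
    then obtain i :: int where "2 * pi * k / n = i * (2 * pi)"
      by (auto simp: cos_one_2pi_int)
    then have "real k = of_int i * n" using n by (simp add: field_simps)
    then have "int k = i * int n" by (metis of_int_eq_iff of_int_mult of_int_of_nat_eq)
    then have "int n dvd int k" by simp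
    then show False using assms by (auto dest: dvd_imp_le)
  qed
  moreover have "(\<Sum>j<n. (\<omega> ^ k) ^ j) * (\<omega> ^ k - 1) = (\<omega> ^ k) ^ n - 1"
    by (simp add: power_diff_1_eq mult.commute)
  moreover have "(\<omega> ^ k) ^ n = 1" using \<open>\<omega> ^ n = 1\<close> by (metis mult.commute power_mult power_one)
  ultimately have "(\<Sum>j<n. (\<omega> ^ k) ^ j) = 0" by simp
  then show ?thesis by (simp add: \<omega>_def flip: power_mult) (simp add: mult.commute)
qed

text \<open>Serves as the norm of a quotient that is never constructed: equality modulo the null
  space reads \<open>p (x - y) = 0\<close>.\<close>

locale complex_seminorm =
  fixes p :: "'v::complex_vector \<Rightarrow> real"
  assumes p_add: "p (x + y) \<le> p x + p y"
    and p_scale: "p (c *\<^sub>C x) = cmod c * p x"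
begin

lemma p_zero: "p 0 = 0"
  using p_scale[of 0 0] by simp

lemma p_minus: "p (- x) = p x"
  using p_scale[of "-1" x] by (simp add: scaleC_one)

lemma p_nonneg: "0 \<le> p x"
  using p_add[of x "- x"] by (simp add: p_minus p_zero)

lemma p_diff: "p (x - y) \<le> p x + p y"
  using p_add[of x "- y"] by (simp add: p_minus)

lemma p_diff_zero:
  assumes "p (x - y) = 0" shows "p x = p y"
  using p_add[of "x - y" y] p_diff[of x "x - y"] assms by simp

lemma p_sum: "p (sum f A) \<le> (\<Sum>i\<in>A. p (f i))"
  by (induction A rule: infinite_finite_induct) (auto simp: p_zero intro: order_trans[OF p_add])

lemma p_trans: "p (x - y) = 0 \<Longrightarrow> p (y - z) = 0 \<Longrightarrow> p (x - z) = 0"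
  using p_add[of "x - y" "y - z"] p_nonneg[of "x - z"] by simp

end

text \<open>A Liouville theorem without integration: \<open>w\<close> plays a resolvent applied to a
  vector, \<open>R \<zeta>\<close> the resolvent operator. Growth makes \<open>p (w \<zeta>)\<close>
  tend to 0 at infinity, so a positive maximum is attained; local power series spread that maximum
  over the plane, against the decay.\<close>

lemma (in complex_seminorm) no_entire_resolvent:
  fixes w :: "complex \<Rightarrow> 'v" and R :: "complex \<Rightarrow> 'v \<Rightarrow> 'v"
  assumes R_add: "\<And>\<zeta> x y. R \<zeta> (x + y) = R \<zeta> x + R \<zeta> y"
    and R_scale: "\<And>\<zeta> c x. R \<zeta> (c *\<^sub>C x) = c *\<^sub>C R \<zeta> x"
    and R_bound: "\<And>\<zeta> x. p (R \<zeta> x) \<le> K \<zeta> * p x"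
    and resolvent: "\<And>\<zeta> h. p (w (\<zeta> + h) - (w \<zeta> + h *\<^sub>C R \<zeta> (w (\<zeta> + h)))) = 0"
    and growth: "\<And>\<zeta>. cmod \<zeta> * p (w \<zeta>) \<le> c + d * p (w \<zeta>)"
    and pos: "p (w 0) > 0"
  shows False
proof -
  define u where "u \<zeta> = p (w \<zeta>)" for \<zeta>
  have u0: "u \<zeta> \<ge> 0" for \<zeta> by (simp add: u_def p_nonneg)
  have K0: "K \<zeta> \<ge> 0" for \<zeta>
    using R_bound[of \<zeta> "w 0"] p_nonneg[of "R \<zeta> (w 0)"] pos
    by (smt (verit) mult_neg_pos)
  have u_diff: "\<bar>u (\<zeta> + h) - u \<zeta>\<bar> \<le> cmod h * K \<zeta> * u (\<zeta> + h)" for \<zeta> h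
  proof -
    have e: "u (\<zeta> + h) = p (w \<zeta> + h *\<^sub>C R \<zeta> (w (\<zeta> + h)))"
      unfolding u_def by (rule p_diff_zero[OF resolvent])
    have b: "p (h *\<^sub>C R \<zeta> (w (\<zeta> + h))) \<le> cmod h * K \<zeta> * u (\<zeta> + h)"
      using mult_left_mono[OF R_bound[of \<zeta> "w (\<zeta> + h)"], of "cmod h"]
      by (simp add: p_scale u_def mult.assoc)
    show ?thesis
      using p_add[of "w \<zeta>" "h *\<^sub>C R \<zeta> (w (\<zeta> + h))"]
        p_diff[of "w \<zeta> + h *\<^sub>C R \<zeta> (w (\<zeta> + h))" "h *\<^sub>C R \<zeta> (w (\<zeta> + h))"] b e
      by (simp add: u_def)
  qed
  have cont: "isCont u \<zeta>" for \<zeta>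
  proof -
    have "((\<lambda>h. u (\<zeta> + h) - u \<zeta>) \<longlongrightarrow> 0) (at 0)"
    proof (rule Lim_null_comparison)
      \<comment> \<open>\<open>u_diff\<close> bounds the increment by the value at the moved point.
        For small \<open>h\<close> the factor is below 1/2, and that value is absorbed into
        \<open>2 * u \<zeta>\<close>.\<close>
      have "((\<lambda>h. cmod h * K \<zeta>) \<longlongrightarrow> 0 * K \<zeta>) (at 0)"
        by (intro tendsto_intros tendsto_norm_zero)
      then have "\<forall>\<^sub>F h in at 0. cmod h * K \<zeta> < 1/2"
        by (intro order_tendstoD(2)) auto
      then show "\<forall>\<^sub>F h in at 0. norm (u (\<zeta> + h) - u \<zeta>) \<le> cmod h * K \<zeta> * (2 * u \<zeta>)"
      proof eventually_elim
        case (elim h)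
        have "u (\<zeta> + h) - u \<zeta> \<le> 1/2 * u (\<zeta> + h)"
          using u_diff[of \<zeta> h] mult_right_mono[of "cmod h * K \<zeta>" "1/2" "u (\<zeta> + h)"] elim u0[of "\<zeta> + h"]
          by linarith
        then have "u (\<zeta> + h) \<le> 2 * u \<zeta>" by simp
        then have "cmod h * K \<zeta> * u (\<zeta> + h) \<le> cmod h * K \<zeta> * (2 * u \<zeta>)"
          by (intro mult_left_mono) (simp_all add: K0)
        then show ?case using u_diff[of \<zeta> h] by simp
      qed
      have "((\<lambda>h. cmod h * K \<zeta> * (2 * u \<zeta>)) \<longlongrightarrow> 0 * K \<zeta> * (2 * u \<zeta>)) (at 0)"
        by (intro tendsto_intros tendsto_norm_zero)
      then show "((\<lambda>h. cmod h * K \<zeta> * (2 * u \<zeta>)) \<longlongrightarrow> 0) (at 0)" by simp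
    qed
    then show ?thesis by (simp add: isCont_iff LIM_zero_iff)
  qed
  \<comment> \<open>The growth bound solved for \<open>cmod \<zeta>\<close>: beyond this radius a
    value of at least \<epsilon> would make \<open>(cmod \<zeta> - d) * u \<zeta>\<close> at least
    \<open>\<epsilon> + \<bar>c\<bar>\<close>.\<close>
  define r where "r \<epsilon> = d + \<bar>c\<bar> / \<epsilon> + 1" for \<epsilon>
  have far: "u \<zeta> < \<epsilon>" if "\<epsilon> > 0" "cmod \<zeta> \<ge> r \<epsilon>" for \<epsilon> \<zeta>
  proof (rule ccontr)
    assume "\<not> u \<zeta> < \<epsilon>"
    then have "(1 + \<bar>c\<bar> / \<epsilon>) * \<epsilon> \<le> (1 + \<bar>c\<bar> / \<epsilon>) * u \<zeta>"
      using that by (intro mult_left_mono) auto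
    also have "\<dots> \<le> (cmod \<zeta> - d) * u \<zeta>"
      using that by (intro mult_right_mono u0) (simp add: r_def)
    also have "\<dots> \<le> c"
      using growth[of \<zeta>] by (simp add: u_def algebra_simps)
    finally have "(1 + \<bar>c\<bar> / \<epsilon>) * \<epsilon> \<le> c" .
    moreover have "(1 + \<bar>c\<bar> / \<epsilon>) * \<epsilon> = \<epsilon> + \<bar>c\<bar>"
      using that by (simp add: distrib_right)
    ultimately show False using that by simp
  qed
  obtain \<zeta>0 where max: "\<And>\<zeta>. u \<zeta> \<le> u \<zeta>0" and K_pos: "u \<zeta>0 > 0"
  proof -
    \<comment> \<open>Outside this ball \<open>u\<close> is below \<open>u 0\<close>; the maximum
      with 0 keeps the centre inside when \<open>r (u 0)\<close> is negative.\<close>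
    define S where "S = cball (0::complex) (max 0 (r (u 0)))"
    have "compact S" "0 \<in> S" by (auto simp: S_def)
    moreover have "continuous_on S u" using cont continuous_at_imp_continuous_on by blast
    ultimately obtain \<zeta>0 where z0: "\<zeta>0 \<in> S" "\<And>\<zeta>. \<zeta> \<in> S \<Longrightarrow> u \<zeta> \<le> u \<zeta>0"
      using continuous_attains_sup[of S u] by blast
    have "u \<zeta> \<le> u \<zeta>0" for \<zeta>
    proof (cases "\<zeta> \<in> S")
      case False
      then have "u \<zeta> < u 0" using pos by (intro far) (auto simp: S_def u_def)
      then show ?thesis using z0(2)[OF \<open>0 \<in> S\<close>] by simp
    qed (rule z0(2))
    moreover have "u \<zeta>0 > 0" using z0(2)[OF \<open>0 \<in> S\<close>] pos by (simp add: u_def)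
    ultimately show thesis using that by blast
  qed
  define B where "B = u \<zeta>0"
  \<comment> \<open>A maximum of \<^term>\<open>u\<close> propagates to a disc: the mean of the resolvent over the vertices of a
    regular \<^term>\<open>n\<close>-gon differs from its value at the centre by \<open>O(q ^ n)\<close>, which beats the
    factor \<open>n\<close> lost by averaging.\<close>
  have propagate: "u (\<zeta> + \<mu>) = B" if uB: "u \<zeta> = B" and q: "cmod \<mu> * K \<zeta> < 1" for \<zeta> \<mu>
  proof -
    define q where "q = cmod \<mu> * K \<zeta>"
    define W where "W = w \<zeta>"
    have R_pow_bound: "p ((R \<zeta> ^^ n) x) \<le> K \<zeta> ^ n * p x" for n x
    proof (induction n)
      case (Suc n)
      have "p ((R \<zeta> ^^ Suc n) x) \<le> K \<zeta> * p ((R \<zeta> ^^ n) x)" by (simp add: R_bound)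
      also have "\<dots> \<le> K \<zeta> * (K \<zeta> ^ n * p x)" by (intro mult_left_mono Suc K0)
      finally show ?case by simp
    qed simp
    have R_pow_add: "(R \<zeta> ^^ n) (x + y) = (R \<zeta> ^^ n) x + (R \<zeta> ^^ n) y" for n x y
      by (induction n) (auto simp: R_add)
    have R_pow_scale: "(R \<zeta> ^^ n) (a *\<^sub>C x) = a *\<^sub>C (R \<zeta> ^^ n) x" for n x a
      by (induction n) (auto simp: R_scale)
    have R_pow_diff: "(R \<zeta> ^^ n) (x - y) = (R \<zeta> ^^ n) x - (R \<zeta> ^^ n) y" for n x y
      using R_pow_add[of n "x - y" y] by simp
    \<comment> \<open>The resolvent identity substituted into itself \<open>n\<close> times: a
      Neumann series with exact remainder.\<close>
    have neumann: "p (w (\<zeta> + h) - ((\<Sum>k<n. h ^ k *\<^sub>C (R \<zeta> ^^ k) W) + h ^ n *\<^sub>C (R \<zeta> ^^ n) (w (\<zeta> + h)))) = 0"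
      for n h
    proof (induction n)
      case 0
      show ?case by (simp add: scaleC_one p_zero)
    next
      case (Suc n)
      define v where "v = w (\<zeta> + h)"
      define s where "s = (\<Sum>k<n. h ^ k *\<^sub>C (R \<zeta> ^^ k) W)"
      have "p ((R \<zeta> ^^ n) (v - (W + h *\<^sub>C R \<zeta> v))) = 0"
        using R_pow_bound[of n "v - (W + h *\<^sub>C R \<zeta> v)"] resolvent[of \<zeta> h]
          p_nonneg[of "(R \<zeta> ^^ n) (v - (W + h *\<^sub>C R \<zeta> v))"]
        by (simp add: v_def W_def)
      then have "p (h ^ n *\<^sub>C (R \<zeta> ^^ n) (v - (W + h *\<^sub>C R \<zeta> v))) = 0"
        by (simp add: p_scale)
      moreover have "h ^ n *\<^sub>C (R \<zeta> ^^ n) (v - (W + h *\<^sub>C R \<zeta> v)) =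
          (s + h ^ n *\<^sub>C (R \<zeta> ^^ n) v) - ((s + h ^ n *\<^sub>C (R \<zeta> ^^ n) W) + h ^ Suc n *\<^sub>C (R \<zeta> ^^ Suc n) v)"
        by (simp add: R_pow_diff R_pow_add R_pow_scale complex_vector.scale_right_diff_distrib
            scaleC_add_right scaleC_scaleC funpow_swap1 mult.commute del: funpow.simps(2))
          (simp add: funpow_swap1)
      ultimately have "p ((s + h ^ n *\<^sub>C (R \<zeta> ^^ n) v) -
          ((s + h ^ n *\<^sub>C (R \<zeta> ^^ n) W) + h ^ Suc n *\<^sub>C (R \<zeta> ^^ Suc n) v)) = 0" by simp
      from p_trans[OF Suc[folded v_def s_def] this]
      show ?case by (simp add: v_def s_def)
    qed
    have lower: "B - real n * (q ^ n * B) \<le> u (\<zeta> + \<mu>)" if n: "n > 0" for n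
    proof -
      define \<omega> where "\<omega> = cis (2 * pi / n)"
      define h where "h j = \<mu> * \<omega> ^ j" for j
      have nh: "cmod (h j) = cmod \<mu>" for j by (simp add: h_def \<omega>_def norm_mult norm_power)
      define E where "E j = w (\<zeta> + h j) -
        ((\<Sum>k<n. h j ^ k *\<^sub>C (R \<zeta> ^^ k) W) + h j ^ n *\<^sub>C (R \<zeta> ^^ n) (w (\<zeta> + h j)))" for j
      have E0: "p (E j) = 0" for j unfolding E_def by (rule neumann)
      have roots: "(\<Sum>j<n. h j ^ k) = (if k = 0 then of_nat n else 0)" if "k < n" for k
      proof (cases "k = 0")
        case False
        have "(\<Sum>j<n. h j ^ k) = \<mu> ^ k * (\<Sum>j<n. (\<omega> ^ j) ^ k)"
          by (simp add: h_def power_mult_distrib sum_distrib_left)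
        then show ?thesis using sum_roots_of_unity_power[of k n] that False by (simp add: \<omega>_def)
      qed simp
      have "(\<Sum>j<n. \<Sum>k<n. h j ^ k *\<^sub>C (R \<zeta> ^^ k) W) = (\<Sum>k<n. (\<Sum>j<n. h j ^ k) *\<^sub>C (R \<zeta> ^^ k) W)"
        by (subst sum.swap) (simp add: complex_vector.scale_sum_left)
      also have "\<dots> = (\<Sum>k<n. if k = 0 then of_nat n *\<^sub>C W else 0)"
        by (intro sum.cong) (auto simp: roots)
      also have "\<dots> = of_nat n *\<^sub>C W" using n by simp
      finally have mean: "(\<Sum>j<n. \<Sum>k<n. h j ^ k *\<^sub>C (R \<zeta> ^^ k) W) = of_nat n *\<^sub>C W" .
      have "of_nat n *\<^sub>C W = (\<Sum>j<n. w (\<zeta> + h j) - h j ^ n *\<^sub>C (R \<zeta> ^^ n) (w (\<zeta> + h j)) - E j)"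
        unfolding mean[symmetric] by (simp add: E_def)
      then have "n * B = p (\<Sum>j<n. w (\<zeta> + h j) - h j ^ n *\<^sub>C (R \<zeta> ^^ n) (w (\<zeta> + h j)) - E j)"
        using uB by (metis W_def norm_of_nat p_scale u_def)
      also have "\<dots> \<le> (\<Sum>j<n. p (w (\<zeta> + h j) - h j ^ n *\<^sub>C (R \<zeta> ^^ n) (w (\<zeta> + h j)) - E j))"
        by (rule p_sum)
      also have "\<dots> \<le> (\<Sum>j<n. u (\<zeta> + h j) + q ^ n * B)"
      proof (rule sum_mono)
        fix j
        have "p (h j ^ n *\<^sub>C (R \<zeta> ^^ n) (w (\<zeta> + h j))) \<le> cmod \<mu> ^ n * (K \<zeta> ^ n * u (\<zeta> + h j))"
          unfolding p_scale norm_power nh u_def by (intro mult_left_mono R_pow_bound) auto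
        also have "\<dots> = q ^ n * u (\<zeta> + h j)" by (simp add: q_def power_mult_distrib)
        also have "\<dots> \<le> q ^ n * B"
          unfolding B_def by (intro mult_left_mono max) (simp add: q_def K0)
        finally show "p (w (\<zeta> + h j) - h j ^ n *\<^sub>C (R \<zeta> ^^ n) (w (\<zeta> + h j)) - E j)
           \<le> u (\<zeta> + h j) + q ^ n * B"
          using p_diff[of "w (\<zeta> + h j) - h j ^ n *\<^sub>C (R \<zeta> ^^ n) (w (\<zeta> + h j))" "E j"] E0[of j]
            p_diff[of "w (\<zeta> + h j)" "h j ^ n *\<^sub>C (R \<zeta> ^^ n) (w (\<zeta> + h j))"]
          by (simp add: u_def)
      qed
      also have "\<dots> = (\<Sum>j<n. u (\<zeta> + h j)) + n * (q ^ n * B)"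
        by (simp add: sum.distrib)
      \<comment> \<open>The vertex \<mu>, at index 0, is kept; the other \<open>n - 1\<close> values
        are replaced by the maximum \<open>B\<close>.\<close>
      also have "(\<Sum>j<n. u (\<zeta> + h j)) = u (\<zeta> + \<mu>) + (\<Sum>j\<in>{..<n} - {0}. u (\<zeta> + h j))"
        using n by (subst sum.remove[of _ 0]) (auto simp: h_def)
      also have "(\<Sum>j\<in>{..<n} - {0}. u (\<zeta> + h j)) \<le> (\<Sum>j\<in>{..<n} - {0}. B)"
        unfolding B_def by (intro sum_mono max)
      also have "\<dots> = (n - 1) * B" using n by simp
      finally show ?thesis using n by (simp add: of_nat_diff algebra_simps)
    qed
    have "(\<lambda>n. real n * q ^ n) \<longlonglongrightarrow> 0"
      using q K0[of \<zeta>] by (intro powser_times_n_limit_0) (simp add: q_def abs_mult)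
    then have "(\<lambda>n. B - real n * q ^ n * B) \<longlonglongrightarrow> B - 0 * B"
      by (intro tendsto_intros)
    moreover have "\<forall>\<^sub>F n in sequentially. B - real n * q ^ n * B \<le> u (\<zeta> + \<mu>)"
      using eventually_gt_at_top[of 0] by eventually_elim (use lower in \<open>simp add: mult.assoc\<close>)
    ultimately have "B - 0 * B \<le> u (\<zeta> + \<mu>)"
      by (rule tendsto_upperbound) simp
    then show ?thesis using max[of "\<zeta> + \<mu>"] by (simp add: B_def)
  qed
  have "open {\<zeta>. u \<zeta> = B}"
    unfolding open_dist
  proof (intro ballI exI conjI allI impI)
    fix \<zeta> \<xi> assume z: "\<zeta> \<in> {\<zeta>. u \<zeta> = B}" and d: "dist \<xi> \<zeta> < inverse (K \<zeta> + 1)"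
    have "cmod (\<xi> - \<zeta>) * K \<zeta> \<le> cmod (\<xi> - \<zeta>) * (K \<zeta> + 1)" by (simp add: algebra_simps)
    also have "\<dots> < inverse (K \<zeta> + 1) * (K \<zeta> + 1)"
      using d K0[of \<zeta>] by (intro mult_strict_right_mono) (auto simp: dist_norm)
    also have "\<dots> = 1" using K0[of \<zeta>] by simp
    finally show "\<xi> \<in> {\<zeta>. u \<zeta> = B}" using propagate[of \<zeta> "\<xi> - \<zeta>"] z by simp
  next
    fix \<zeta> show "0 < inverse (K \<zeta> + 1)" using K0[of \<zeta>] by simp
  qed
  moreover have "closed {\<zeta>. u \<zeta> = B}"
    using cont by (intro closed_Collect_eq) (auto simp: continuous_at_imp_continuous_on)
  moreover have "\<zeta>0 \<in> {\<zeta>. u \<zeta> = B}" by (simp add: B_def)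
  ultimately have "{\<zeta>. u \<zeta> = B} = UNIV" using clopen[of "{\<zeta>. u \<zeta> = B}"] by blast
  \<comment> \<open>A point so far out that the decay forces \<open>u\<close> below its supposedly
    constant value \<open>B\<close>.\<close>
  then have "of_real \<bar>r B\<bar> \<in> {\<zeta>. u \<zeta> = B}" by (simp only: UNIV_I)
  then have "u (of_real \<bar>r B\<bar>) = B" by simp
  moreover have "u (of_real \<bar>r B\<bar>) < B" using K_pos by (intro far) (auto simp: B_def)
  ultimately show False by simp
qed

section \<open>Maximal modular left ideals\<close>

lemma infdist_image_le:
  fixes M :: "'a::metric_space set" and N :: "'b::metric_space set"
  assumes ne: "M \<noteq> {}" and c: "0 \<le> c" and f: "\<And>m. m \<in> M \<Longrightarrow> f m \<in> N"
    and d: "\<And>m. m \<in> M \<Longrightarrow> dist (f x) (f m) \<le> c * dist x m"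
  shows "infdist (f x) N \<le> c * infdist x M"
proof -
  have le: "infdist (f x) N \<le> c * dist x m" if "m \<in> M" for m
    using infdist_le2[OF f d] that by blast
  show ?thesis
  proof (cases "c = 0")
    case True
    then show ?thesis using le ne by auto
  next
    case False
    then have "infdist (f x) N / c \<le> infdist x M"
      unfolding infdist_notempty[OF ne] using le c
      by (intro cINF_greatest[OF ne]) (simp add: divide_le_eq mult.commute)
    then show ?thesis using False c by (simp add: divide_le_eq mult.commute)
  qed
qed


text \<open>With an identity, \<open>g\<close> would be \<open>(1 - y)^-1 - 1\<close>. The
  contraction \<open>g \<mapsto> y + g * y\<close> produces it without one.\<close>

lemma left_quasi_inverse:
  fixes y :: "'a::{real_normed_algebra,banach}"
  assumes "norm y < 1"
  obtains g where "g = y + g * y"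
proof -
  have "\<exists>!g. y + g * y = g"
  proof (rule banach_fix_type)
    show "\<forall>g h. dist (y + g * y) (y + h * y) \<le> norm y * dist g h"
      by (simp add: dist_norm left_diff_distrib[symmetric])
        (metis mult.commute norm_mult_ineq)
  qed (use assms in auto)
  then show thesis using that by metis
qed

lemma continuous_on_scaleC_right:
  "continuous_on S (\<lambda>x::'a::complex_banach_algebra. c *\<^sub>C x)"
proof -
  have "bounded_linear (\<lambda>x::'a. c *\<^sub>C x)"
  proof (rule bounded_linear_intro[where K = "cmod c"])
    show "norm (c *\<^sub>C x) \<le> norm x * cmod c" for x :: 'a by (simp add: norm_scaleC)
  qed (simp_all add: scaleC_add_right scaleR_scaleC scaleC_scaleC mult.commute)
  then show ?thesis by (simp add: linear_continuous_on)
qed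

lemma left_ideal_closure:
  assumes "left_ideal (I :: 'a::complex_banach_algebra set)"
  shows "left_ideal (closure I)"
  unfolding left_ideal_def complex_vector.subspace_def
proof (intro conjI ballI allI)
  have I: "0 \<in> I" "\<And>x y. x \<in> I \<Longrightarrow> y \<in> I \<Longrightarrow> x + y \<in> I"
    "\<And>c x. x \<in> I \<Longrightarrow> c *\<^sub>C x \<in> I" "\<And>x y. y \<in> I \<Longrightarrow> x * y \<in> I"
    using assms by (auto simp: left_ideal_def complex_vector.subspace_def)
  show "0 \<in> closure I" using I(1) closure_subset by auto
  show "x + y \<in> closure I" if "x \<in> closure I" "y \<in> closure I" for x y
  proof -
    obtain a where a: "\<forall>n. a n \<in> I" "a \<longlonglongrightarrow> x"
      using \<open>x \<in> closure I\<close> unfolding closure_sequential by blast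
    obtain b where b: "\<forall>n. b n \<in> I" "b \<longlonglongrightarrow> y"
      using \<open>y \<in> closure I\<close> unfolding closure_sequential by blast
    then have "(\<lambda>n. a n + b n) \<longlonglongrightarrow> x + y" using a b by (intro tendsto_intros)
    then show ?thesis
      unfolding closure_sequential using a(1) b(1) I(2) by (intro exI[of _ "\<lambda>n. a n + b n"]) simp
  qed
  show "c *\<^sub>C x \<in> closure I" if "x \<in> closure I" for c x
  proof -
    have "(\<lambda>x. c *\<^sub>C x) ` closure I \<subseteq> closure I"
      by (rule image_closure_subset[OF continuous_on_scaleC_right closed_closure])
        (auto intro: I(3) subsetD[OF closure_subset])
    then show ?thesis using that by blast
  qed
  show "x * y \<in> closure I" if "y \<in> closure I" for x y
  proof -
    have "(\<lambda>y. x * y) ` closure I \<subseteq> closure I"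
      by (rule image_closure_subset[OF _ closed_closure])
        (auto intro!: continuous_intros intro: I(4) subsetD[OF closure_subset])
    then show ?thesis using that by blast
  qed
qed

locale max_modular =
  fixes M :: "'a::complex_banach_algebra set"
  assumes max_modular: "maximal_modular_left_ideal M"
begin

lemma ideal: "left_ideal M"
  using max_modular by (simp add: maximal_modular_left_ideal_def modular_left_ideal_def)

lemma zero: "0 \<in> M"
  and add: "x \<in> M \<Longrightarrow> y \<in> M \<Longrightarrow> x + y \<in> M"
  and scale: "x \<in> M \<Longrightarrow> c *\<^sub>C x \<in> M"
  and mult: "x \<in> M \<Longrightarrow> y * x \<in> M"
  using ideal by (auto simp: left_ideal_def complex_vector.subspace_def)

lemma diff: "x \<in> M \<Longrightarrow> y \<in> M \<Longrightarrow> x - y \<in> M"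
  using ideal complex_vector.subspace_diff by (auto simp: left_ideal_def)

lemma maximal: "left_ideal J \<Longrightarrow> M \<subseteq> J \<Longrightarrow> J = M \<or> J = UNIV"
  using max_modular by (auto simp: maximal_modular_left_ideal_def)

definition unit :: 'a where
  "unit = (SOME e. \<forall>x. x - x * e \<in> M)"

lemma mult_unit: "x - x * unit \<in> M"
proof -
  have "\<exists>e. \<forall>x. x - x * e \<in> M"
    using max_modular by (simp add: maximal_modular_left_ideal_def modular_left_ideal_def)
  from someI_ex[OF this] show ?thesis unfolding unit_def by blast
qed

lemma proper: assumes "\<And>x. x * unit \<in> M" shows False
proof -
  have "x \<in> M" for x using add[OF mult_unit[of x] assms[of x]] by simp
  then show False using max_modular by (auto simp: maximal_modular_left_ideal_def)
qed

lemma unit_notin: "unit \<notin> M"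
  using proper mult by blast

text \<open>If \<open>m\<close> in \<open>M\<close> were at distance below 1 from
  \<open>unit\<close>, then \<open>y = unit - m\<close> would have a quasi-inverse \<open>g\<close>,
  and \<open>y = (g - g * unit) + g * m\<close> would lie in \<open>M\<close>, taking
  \<open>unit\<close> along. So \<open>M\<close> is not dense, and maximality makes it
  closed.\<close>

lemma unit_in_closure: "unit \<notin> closure M"
proof
  assume "unit \<in> closure M"
  then obtain m where m: "m \<in> M" "dist m unit < 1"
    by (metis closure_approachable zero_less_one)
  define y where "y = unit - m"
  have "norm y < 1" using m by (simp add: y_def dist_norm norm_minus_commute)
  then obtain g where "g = y + g * y" by (rule left_quasi_inverse)
  then have "y = (g - g * unit) + g * m" by (simp add: y_def algebra_simps)
  also have "\<dots> \<in> M" using m by (intro add mult mult_unit)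
  finally have "y + m \<in> M" using m add by blast
  then show False using unit_notin by (simp add: y_def)
qed

lemma closed: "closed M"
proof -
  have "closure M = M"
    using maximal[OF left_ideal_closure[OF ideal] closure_subset] unit_in_closure by auto
  then show ?thesis by (metis closed_closure)
qed

text \<open>The simple module \<open>A / M\<close> has no nonzero vector annihilated by the whole
  algebra: such vectors come from a left ideal, which the modular unit keeps from being
  everything.\<close>

lemma notin_imp_mult_notin:
  assumes "a \<notin> M" obtains x where "x * a \<notin> M"
proof -
  define J where "J = {a. \<forall>x. x * a \<in> M}"
  have "left_ideal J"
    unfolding left_ideal_def complex_vector.subspace_def J_def
    by (auto simp: zero add scale distrib_left scaleC_mult_right simp flip: mult.assoc)
  moreover have "M \<subseteq> J" by (auto simp: J_def mult)
  moreover have "J \<noteq> UNIV" using proper by (auto simp: J_def)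
  ultimately have "J = M" using maximal by blast
  then show thesis using assms that by (auto simp: J_def)
qed

text \<open>If \<open>a\<close> were outside \<open>M\<close>, maximality would write
  \<open>unit = x * a + m\<close>. Multiplying by \<open>a\<close> on the left kills the first term,
  so \<open>a * unit\<close>, and with it \<open>a\<close>, falls into \<open>M\<close>.\<close>

lemma semiprime:
  assumes "\<And>x. a * x * a = 0" shows "a \<in> M"
proof (rule ccontr)
  assume a: "a \<notin> M"
  define J where "J = {x * a + m | x m. m \<in> M}"
  have "left_ideal J"
    unfolding left_ideal_def complex_vector.subspace_def J_def
  proof (safe)
    show "\<exists>x m. 0 = x * a + m \<and> m \<in> M" by (rule exI[of _ 0], rule exI[of _ 0]) (simp add: zero)
    fix x m x' m' assume "m \<in> M" "m' \<in> M"
    then show "\<exists>y n. x * a + m + (x' * a + m') = y * a + n \<and> n \<in> M"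
      by (intro exI[of _ "x + x'"] exI[of _ "m + m'"]) (simp add: add algebra_simps)
  next
    fix c x m assume "m \<in> M"
    then show "\<exists>y n. c *\<^sub>C (x * a + m) = y * a + n \<and> n \<in> M"
      by (intro exI[of _ "c *\<^sub>C x"] exI[of _ "c *\<^sub>C m"])
        (simp add: scale scaleC_add_right scaleC_mult_left)
  next
    fix z x m assume "m \<in> M"
    then show "\<exists>y n. z * (x * a + m) = y * a + n \<and> n \<in> M"
      by (intro exI[of _ "z * x"] exI[of _ "z * m"]) (simp add: mult distrib_left mult.assoc)
  qed
  moreover have "M \<subseteq> J"
    unfolding J_def by clarify (metis add.left_neutral mult_zero_left)
  moreover have "J \<noteq> M"
  proof -
    \<comment> \<open>Without an identity \<open>a\<close> need not visibly belong to
      \<open>J\<close>, so a multiple of \<open>a\<close> outside \<open>M\<close> takes its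
      place.\<close>
    obtain x where "x * a \<notin> M" using notin_imp_mult_notin[OF a] .
    moreover have "x * a \<in> J" unfolding J_def using zero by force
    ultimately show ?thesis by blast
  qed
  ultimately have "unit \<in> J" using maximal by blast
  then obtain x m where xm: "unit = x * a + m" "m \<in> M" by (auto simp: J_def)
  have "a * unit = a * m" by (simp add: xm distrib_left assms flip: mult.assoc)
  then have "a * unit \<in> M" using xm mult by simp
  then have "a \<in> M" using add[OF mult_unit[of a]] by force
  then show False using a by blast
qed

text \<open>The distance to \<open>M\<close> is the quotient norm of \<open>A / M\<close>.
  Homogeneity needs one inequality only, applied again with the inverse scalar.\<close>

sublocale complex_seminorm "\<lambda>x. infdist x M"
proof
  have ne: "M \<noteq> {}" using zero by blast
  show "infdist (x + y) M \<le> infdist x M + infdist y M" for x y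
  proof -
    have "infdist (x + y) M \<le> infdist x M + dist y b" if b: "b \<in> M" for b
    proof -
      have "infdist (x + y) M \<le> infdist (x + b) M + dist y b"
        using infdist_triangle[of "x + y" M "x + b"] by (simp add: dist_norm)
      moreover have "infdist (x + b) M \<le> 1 * infdist x M"
        by (rule infdist_image_le[OF ne]) (use b add in auto)
      ultimately show ?thesis by simp
    qed
    then have "infdist (x + y) M - infdist x M \<le> infdist y M"
      unfolding infdist_notempty[OF ne, of y] by (intro cINF_greatest[OF ne]) (simp add: algebra_simps)
    then show ?thesis by simp
  qed
  have le: "infdist (c *\<^sub>C x) M \<le> cmod c * infdist x M" for c x
    by (rule infdist_image_le[OF ne])
      (simp_all add: scale dist_norm norm_scaleC flip: complex_vector.scale_right_diff_distrib)
  show "infdist (c *\<^sub>C x) M = cmod c * infdist x M" for c x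
  proof (cases "c = 0")
    case True
    then show ?thesis using zero by simp
  next
    case False
    have "cmod c * infdist x M = cmod c * infdist (inverse c *\<^sub>C c *\<^sub>C x) M"
      using False by (simp add: scaleC_scaleC scaleC_one)
    also have "\<dots> \<le> cmod c * (cmod (inverse c) * infdist (c *\<^sub>C x) M)"
      by (intro mult_left_mono le) auto
    also have "\<dots> = infdist (c *\<^sub>C x) M" using False by (simp add: norm_inverse)
    finally show ?thesis using le[of c x] by simp
  qed
qed

lemma infdist_zero_iff: "infdist x M = 0 \<longleftrightarrow> x \<in> M"
  using in_closed_iff_infdist_zero[OF closed, of x] zero by auto

lemma infdist_mult_right:
  assumes "\<And>m. m \<in> M \<Longrightarrow> m * v \<in> M"
  shows "infdist (x * v) M \<le> norm v * infdist x M"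
proof (rule infdist_image_le)
  show "dist (x * v) (m * v) \<le> norm v * dist x m" for m
    using norm_mult_ineq[of "x - m" v] by (simp add: dist_norm left_diff_distrib mult.commute)
qed (use assms zero in auto)

lemma infdist_mult_left: "infdist (v * x) M \<le> norm v * infdist x M"
proof (rule infdist_image_le)
  show "dist (v * x) (v * m) \<le> norm v * dist x m" for m
    using norm_mult_ineq[of v "x - m"] by (simp add: dist_norm right_diff_distrib)
qed (use mult zero in auto)

text \<open>Schur's lemma and the Gelfand--Mazur argument: a central element acts on the simple module
  \<open>A / M\<close> as a scalar. The resolvent of its action is right multiplication by the elements
  \<open>w \<zeta>\<close> below.\<close>

theorem central_acts_as_scalar:
  assumes central: "\<And>x. z * x = x * z"
  shows "\<exists>\<zeta>. \<forall>x. z * x - \<zeta> *\<^sub>C x \<in> M"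
proof (rule ccontr)
  assume neg: "\<nexists>\<zeta>. \<forall>x. z * x - \<zeta> *\<^sub>C x \<in> M"
  define A where "A \<zeta> x = z * x - \<zeta> *\<^sub>C x" for \<zeta> x
  have A_add: "A \<zeta> (x + y) = A \<zeta> x + A \<zeta> y" for \<zeta> x y
    by (simp add: A_def algebra_simps scaleC_add_right)
  have A_diff: "A \<zeta> (x - y) = A \<zeta> x - A \<zeta> y" for \<zeta> x y
    by (simp add: A_def algebra_simps complex_vector.scale_right_diff_distrib)
  have A_scale: "A \<zeta> (c *\<^sub>C x) = c *\<^sub>C A \<zeta> x" for \<zeta> c x
    by (simp add: A_def complex_vector.scale_right_diff_distrib scaleC_mult_right
        scaleC_scaleC mult.commute)
  have A_mult: "A \<zeta> (y * x) = y * A \<zeta> x" for \<zeta> x y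
    by (simp add: A_def right_diff_distrib scaleC_mult_right central mult.assoc)
  have A_mult': "A \<zeta> (y * x) = A \<zeta> y * x" for \<zeta> x y
    by (simp add: A_def left_diff_distrib scaleC_mult_left mult.assoc)
  have A_shift: "A \<zeta> x = A (\<zeta> + h) x + h *\<^sub>C x" for \<zeta> h x
    by (simp add: A_def scaleC_add_left)
  have A_M: "A \<zeta> m \<in> M" if "m \<in> M" for \<zeta> m
    unfolding A_def using that by (intro diff mult scale)
  \<comment> \<open>Kernel and, below, range of \<open>A \<zeta>\<close> modulo \<open>M\<close>
    give left ideals containing \<open>M\<close>, so maximality makes the operator bijective on
    \<open>A / M\<close>.\<close>
  have inj: "x \<in> M" if "A \<zeta> x \<in> M" for \<zeta> x
  proof -
    define J where "J = {x. A \<zeta> x \<in> M}"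
    have "A \<zeta> 0 = 0" by (simp add: A_def)
    then have "left_ideal J"
      unfolding left_ideal_def complex_vector.subspace_def J_def
      by (simp add: zero add scale mult A_add A_scale A_mult)
    moreover have "M \<subseteq> J" using A_M by (auto simp: J_def)
    moreover have "J \<noteq> UNIV" using neg by (auto simp: J_def A_def)
    ultimately have "J = M" using maximal by blast
    then show ?thesis using that by (auto simp: J_def)
  qed
  have "\<exists>w. unit - A \<zeta> w \<in> M" for \<zeta>
  proof -
    define J where "J = {y. \<exists>x. y - A \<zeta> x \<in> M}"
    have "left_ideal J"
      unfolding left_ideal_def complex_vector.subspace_def J_def
    proof (intro conjI ballI allI; clarify?)
      show "\<exists>x. 0 - A \<zeta> x \<in> M" using zero by (auto intro!: exI[of _ 0] simp: A_def)
    next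
      fix y x y' x' assume "y - A \<zeta> x \<in> M" "y' - A \<zeta> x' \<in> M"
      then have "(y - A \<zeta> x) + (y' - A \<zeta> x') \<in> M" by (rule add)
      then show "\<exists>v. y + y' - A \<zeta> v \<in> M"
        by (intro exI[of _ "x + x'"]) (simp add: A_add algebra_simps)
    next
      fix c y x assume "y - A \<zeta> x \<in> M"
      then have "c *\<^sub>C (y - A \<zeta> x) \<in> M" by (rule scale)
      then show "\<exists>v. c *\<^sub>C y - A \<zeta> v \<in> M"
        by (intro exI[of _ "c *\<^sub>C x"]) (simp add: A_scale complex_vector.scale_right_diff_distrib)
    next
      fix t y x assume "y - A \<zeta> x \<in> M"
      then have "t * (y - A \<zeta> x) \<in> M" by (rule mult)
      then show "\<exists>v. t * y - A \<zeta> v \<in> M"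
        by (intro exI[of _ "t * x"]) (simp add: A_mult right_diff_distrib)
    qed
    moreover have "M \<subseteq> J" using zero by (auto intro!: exI[of _ 0] simp: J_def A_def)
    moreover have "J \<noteq> M"
    proof -
      obtain x where "A \<zeta> x \<notin> M" using neg by (auto simp: A_def)
      moreover have "A \<zeta> x \<in> J" using zero by (auto intro!: exI[of _ x] simp: J_def)
      ultimately show ?thesis by blast
    qed
    ultimately have "unit \<in> J" using maximal by blast
    then show ?thesis by (simp add: J_def)
  qed
  then obtain w where w: "unit - A \<zeta> (w \<zeta>) \<in> M" for \<zeta> by metis
  \<comment> \<open>\<open>M\<close> is only a left ideal, so this is what makes right
    multiplication by \<open>w \<zeta>\<close> well defined on \<open>A / M\<close>.\<close>
  have mw: "m * w \<zeta> \<in> M" if m: "m \<in> M" for m \<zeta>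
  proof (rule inj)
    have "A \<zeta> (m * w \<zeta>) = m - ((m - m * unit) + m * (unit - A \<zeta> (w \<zeta>)))"
      by (simp add: A_mult algebra_simps)
    also have "\<dots> \<in> M" by (rule diff[OF m add[OF mult_unit mult[OF w]]])
    finally show "A \<zeta> (m * w \<zeta>) \<in> M" .
  qed
  have ew: "unit * w \<zeta> - w \<zeta> \<in> M" for \<zeta>
  proof (rule inj)
    have "A \<zeta> (unit * w \<zeta> - w \<zeta>) =
        (unit - A \<zeta> (w \<zeta>)) - unit * (unit - A \<zeta> (w \<zeta>)) - (unit - unit * unit)"
      by (simp add: A_diff A_mult algebra_simps)
    also have "\<dots> \<in> M" by (intro diff mult w mult_unit)
    finally show "A \<zeta> (unit * w \<zeta> - w \<zeta>) \<in> M" .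
  qed
  \<comment> \<open>The identity \<open>(z - \<zeta> - h)^-1 = (z - \<zeta>)^-1 + h (z - \<zeta> -
    h)^-1 (z - \<zeta>)^-1\<close> modulo \<open>M\<close>, checked after applying the injective
    \<open>A (\<zeta> + h)\<close>.\<close>
  have resolvent: "w (\<zeta> + h) - (w \<zeta> + h *\<^sub>C (w (\<zeta> + h) * w \<zeta>)) \<in> M" for \<zeta> h
  proof (rule inj)
    define v where "v = w (\<zeta> + h)"
    have "A (\<zeta> + h) (v - (w \<zeta> + h *\<^sub>C (v * w \<zeta>))) =
       A (\<zeta> + h) v - (A \<zeta> (w \<zeta>) - h *\<^sub>C w \<zeta>) - h *\<^sub>C (A (\<zeta> + h) v * w \<zeta>)"
      by (simp add: A_diff A_add A_scale A_mult' A_shift[of \<zeta> "w \<zeta>" h])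
    also have "\<dots> = (unit - A \<zeta> (w \<zeta>)) - (unit - A (\<zeta> + h) v)
       + h *\<^sub>C ((unit - A (\<zeta> + h) v) * w \<zeta>) - h *\<^sub>C (unit * w \<zeta> - w \<zeta>)"
      by (simp add: algebra_simps complex_vector.scale_right_diff_distrib)
    also have "\<dots> \<in> M" unfolding v_def by (intro diff add scale mw w ew)
    finally show "A (\<zeta> + h) (w (\<zeta> + h) - (w \<zeta> + h *\<^sub>C (w (\<zeta> + h) * w \<zeta>))) \<in> M"
      by (simp add: v_def)
  qed
  show False
  proof (rule no_entire_resolvent[where w = w and R = "\<lambda>\<zeta> x. x * w \<zeta>"
        and K = "\<lambda>\<zeta>. norm (w \<zeta>)" and c = "infdist unit M" and d = "norm z"])
    show "infdist (x * w \<zeta>) M \<le> norm (w \<zeta>) * infdist x M" for x \<zeta>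
      by (rule infdist_mult_right) (rule mw)
    show "infdist (w (\<zeta> + h) - (w \<zeta> + h *\<^sub>C (w (\<zeta> + h) * w \<zeta>))) M = 0" for \<zeta> h
      by (simp add: infdist_zero_iff resolvent)
    \<comment> \<open>Write \<open>\<zeta> w = z w - (z - \<zeta>) w\<close>; the last term is
      \<open>unit\<close> modulo \<open>M\<close>.\<close>
    show "cmod \<zeta> * infdist (w \<zeta>) M \<le> infdist unit M + norm z * infdist (w \<zeta>) M" for \<zeta>
    proof -
      have "infdist (unit - A \<zeta> (w \<zeta>)) M = 0" by (simp add: infdist_zero_iff w)
      then have "infdist (A \<zeta> (w \<zeta>)) M = infdist unit M" by (metis p_diff_zero)
      moreover have "cmod \<zeta> * infdist (w \<zeta>) M \<le> infdist (z * w \<zeta>) M + infdist (A \<zeta> (w \<zeta>)) M"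
        using p_diff[of "z * w \<zeta>" "A \<zeta> (w \<zeta>)"] by (simp add: A_def p_scale)
      ultimately show ?thesis using infdist_mult_left[of z "w \<zeta>"] by simp
    qed
    have "w 0 \<notin> M"
    proof
      assume "w 0 \<in> M"
      then have "(unit - A 0 (w 0)) + A 0 (w 0) \<in> M" by (intro add w A_M)
      then show False using unit_notin by simp
    qed
    then show "0 < infdist (w 0) M"
      using infdist_zero_iff[of "w 0"] infdist_nonneg[of "w 0" M] by linarith
  qed (simp_all add: distrib_right scaleC_mult_left)
qed

section \<open>The central character of the simple module \<open>A / M\<close>\<close>

definition char :: "'a \<Rightarrow> complex" where
  "char z = (SOME \<zeta>. \<forall>x. z * x - \<zeta> *\<^sub>C x \<in> M)"

lemma char: "z \<in> algebra_center \<Longrightarrow> z * x - char z *\<^sub>C x \<in> M"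
proof -
  assume "z \<in> algebra_center"
  then have "\<exists>\<zeta>. \<forall>x. z * x - \<zeta> *\<^sub>C x \<in> M"
    by (intro central_acts_as_scalar) (simp add: algebra_center_def)
  from someI_ex[OF this] show ?thesis unfolding char_def by blast
qed

lemma scale_unit_in: "c *\<^sub>C unit \<in> M \<Longrightarrow> c = 0"
  using scale[of "c *\<^sub>C unit" "inverse c"] unit_notin
  by (cases "c = 0") (auto simp: scaleC_scaleC scaleC_one)

lemma char_eqI:
  assumes z: "z \<in> algebra_center" and "z * unit - c *\<^sub>C unit \<in> M"
  shows "char z = c"
proof -
  have "(z * unit - c *\<^sub>C unit) - (z * unit - char z *\<^sub>C unit) \<in> M"
    by (rule diff[OF assms(2) char[OF z]])
  then have "(char z - c) *\<^sub>C unit \<in> M"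
    by (simp add: complex_vector.scale_left_diff_distrib)
  then show ?thesis using scale_unit_in by fastforce
qed

lemma char_mult:
  assumes "y \<in> algebra_center" "z \<in> algebra_center" "y * z \<in> algebra_center"
  shows "char (y * z) = char y * char z"
proof (rule char_eqI[OF assms(3)])
  have "y * z * unit - (char y * char z) *\<^sub>C unit =
      y * (z * unit - char z *\<^sub>C unit) + char z *\<^sub>C (y * unit - char y *\<^sub>C unit)"
    by (simp add: algebra_simps complex_vector.scale_right_diff_distrib scaleC_mult_right scaleC_scaleC)
  also have "\<dots> \<in> M" using assms by (intro add mult scale char)
  finally show "y * z * unit - (char y * char z) *\<^sub>C unit \<in> M" .
qed

lemma char_add:
  assumes "y \<in> algebra_center" "z \<in> algebra_center" "y + z \<in> algebra_center"
  shows "char (y + z) = char y + char z"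
proof (rule char_eqI[OF assms(3)])
  have "(y + z) * unit - (char y + char z) *\<^sub>C unit =
      (y * unit - char y *\<^sub>C unit) + (z * unit - char z *\<^sub>C unit)"
    by (simp add: algebra_simps scaleC_add_left)
  also have "\<dots> \<in> M" using assms by (intro add char)
  finally show "(y + z) * unit - (char y + char z) *\<^sub>C unit \<in> M" .
qed

lemma char_scale:
  assumes "z \<in> algebra_center" "c *\<^sub>C z \<in> algebra_center"
  shows "char (c *\<^sub>C z) = c * char z"
proof (rule char_eqI[OF assms(2)])
  have "c *\<^sub>C z * unit - (c * char z) *\<^sub>C unit = c *\<^sub>C (z * unit - char z *\<^sub>C unit)"
    by (simp add: complex_vector.scale_right_diff_distrib scaleC_mult_left scaleC_scaleC)
  also have "\<dots> \<in> M" using assms by (intro scale char)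
  finally show "c *\<^sub>C z * unit - (c * char z) *\<^sub>C unit \<in> M" .
qed

lemma char_zero_imp:
  assumes "z \<in> algebra_center" "char z = 0"
  shows "z \<in> M"
  using add[OF mult_unit[of z] char[OF assms(1), of unit]] assms(2) by simp

end

lemma semisimple_notin_max_modular:
  assumes "semisimple TYPE('a::complex_banach_algebra)" "(x :: 'a) \<noteq> 0"
  obtains M where "max_modular M" "x \<notin> M"
proof -
  have "x \<notin> jacobson_radical"
    using assms(2) assms(1)[unfolded semisimple_def] by (metis singletonD)
  then show thesis using that by (auto simp: jacobson_radical_def max_modular_def)
qed

lemma semisimple_imp_semiprime:
  assumes "semisimple TYPE('a::complex_banach_algebra)" "\<And>x. a * x * a = (0 :: 'a)"
  shows "a = 0"
  using semisimple_notin_max_modular[OF assms(1)] max_modular.semiprime[OF _ assms(2)] by blast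

section \<open>Gliding humps and closed graphs\<close>

lemma Baire_complete:
  fixes U :: "nat \<Rightarrow> 'a::complete_space set"
  assumes "\<And>n. open (U n)" "\<And>n. closure (U n) = UNIV"
  shows "closure (\<Inter>n. U n) = UNIV"
proof -
  have "euclidean closure_of \<Inter>(range U) = topspace euclidean"
    by (rule Baire_category)
      (use assms in \<open>auto simp: completely_metrizable_space_euclidean\<close>)
  then show ?thesis by simp
qed

text \<open>The composite of \<open>L n\<close>, ..., \<open>L (n + k - 1)\<close>. The starting
  index varies because tails of the hump series begin at every \<open>n\<close>.\<close>

primrec iterated :: "(nat \<Rightarrow> 'a \<Rightarrow> 'a) \<Rightarrow> nat \<Rightarrow> nat \<Rightarrow> 'a \<Rightarrow> 'a" where
  "iterated L n 0 = id"
| "iterated L n (Suc k) = L n \<circ> iterated L (Suc n) k"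

lemma iterated_Suc: "iterated L n (Suc k) = iterated L n k \<circ> L (n + k)"
proof (induction k arbitrary: n)
  case (Suc k)
  have "iterated L n (Suc (Suc k)) = L n \<circ> iterated L (Suc n) (Suc k)" by simp
  also have "\<dots> = L n \<circ> (iterated L (Suc n) k \<circ> L (Suc n + k))" by (simp only: Suc.IH)
  also have "\<dots> = iterated L n (Suc k) \<circ> L (n + Suc k)" by (simp add: o_assoc)
  finally show ?case .
qed simp

text \<open>In the proof, the tail \<open>T n\<close> of the constructed series satisfies \<open>T n = y n + L n (T (n + 1))\<close>, so that \<open>f n\<close> is
  bounded on everything behind the \<open>n\<close>-th hump.\<close>

lemma gliding_hump:
  fixes f :: "nat \<Rightarrow> 'a::banach \<Rightarrow> real" and L :: "nat \<Rightarrow> 'a \<Rightarrow> 'a"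
  assumes f_add: "\<And>n x y. f n (x + y) \<le> f n x + f n y"
    and f_minus: "\<And>n x. f n (- x) = f n x"
    and L_lin: "\<And>n. bounded_linear (L n)" and L_norm: "\<And>n x. norm (L n x) \<le> norm x"
    and bounded: "\<And>n x. f n (iterated L 0 (Suc n) x) \<le> C n * norm x"
    and unbounded: "\<And>n K e. e > 0 \<Longrightarrow> \<exists>x. norm x \<le> e \<and> f n (iterated L 0 n x) \<ge> K"
  shows "\<exists>x. \<forall>n. f n x \<ge> real n"
proof -
  \<comment> \<open>The \<open>n\<close>-th hump has to exceed the earlier humps by
    \<open>n\<close>, plus \<open>2 * \<bar>C n\<bar>\<close> for the later ones, whose tail has
    norm at most 2.\<close>
  define good where "good y n v \<longleftrightarrow> norm v \<le> (1/2) ^ n \<and>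
    f n (iterated L 0 n v) \<ge> real n + f n (- (\<Sum>j<n. iterated L 0 j (y j))) + 2 * \<bar>C n\<bar>"
    for y :: "nat \<Rightarrow> 'a" and n v
  have "\<exists>y. \<forall>n. good y n (y n)"
  proof (rule dependent_wellorder_choice)
    fix v and y y' :: "nat \<Rightarrow> 'a" and n
    assume "\<And>m. m < n \<Longrightarrow> y m = y' m"
    then show "good y n v = good y' n v" by (simp add: good_def)
  next
    fix n and y :: "nat \<Rightarrow> 'a"
    show "\<exists>v. good y n v"
      unfolding good_def by (rule unbounded) simp
  qed
  then obtain y where y: "good y n (y n)" for n by blast
  have it_lin: "bounded_linear (iterated L n k)" for n k
  proof (induction k arbitrary: n)
    case 0
    show ?case by (simp add: id_def bounded_linear_ident)
  next
    case (Suc k)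
    show ?case using bounded_linear_compose[OF L_lin Suc] by (simp add: comp_def)
  qed
  have it_norm: "norm (iterated L n k x) \<le> norm x" for n k x
    by (induction k arbitrary: n) (auto intro: order_trans[OF L_norm])
  have y_norm: "norm (y n) \<le> (1/2) ^ n" for n using y[of n] by (simp add: good_def)
  define T where "T n = (\<Sum>k. iterated L n k (y (n + k)))" for n
  have term_le: "norm (iterated L n k (y (n + k))) \<le> (1/2) ^ k" for n k
  proof -
    have "norm (iterated L n k (y (n + k))) \<le> (1/2) ^ (n + k)"
      using it_norm y_norm by (rule order_trans)
    also have "\<dots> \<le> (1/2) ^ k" by (rule power_decreasing) auto
    finally show ?thesis .
  qed
  have geo: "summable (\<lambda>k. (1/2 :: real) ^ k)" by (rule summable_geometric) simp
  have summ: "summable (\<lambda>k. iterated L n k (y (n + k)))" for n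
    by (rule summable_comparison_test'[OF geo, of 0]) (use term_le in simp)
  have T_norm: "norm (T n) \<le> 2" for n
  proof -
    have "norm (T n) \<le> (\<Sum>k. (1/2 :: real) ^ k)"
      unfolding T_def by (rule norm_suminf_le[OF term_le geo])
    then show ?thesis by (simp add: suminf_geometric)
  qed
  have T_step: "T n = y n + L n (T (Suc n))" for n
  proof -
    have "T n = y n + (\<Sum>k. iterated L n (Suc k) (y (n + Suc k)))"
      unfolding T_def using suminf_split_head[OF summ[of n]] by (simp add: algebra_simps)
    also have "(\<Sum>k. iterated L n (Suc k) (y (n + Suc k))) =
        (\<Sum>k. L n (iterated L (Suc n) k (y (Suc n + k))))" by simp
    also have "\<dots> = L n (T (Suc n))"
      unfolding T_def by (rule bounded_linear.suminf[OF L_lin summ, symmetric])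
    finally show ?thesis .
  qed
  have expand: "T 0 = (\<Sum>j<n. iterated L 0 j (y j)) + iterated L 0 n (T n)" for n
  proof (induction n)
    case (Suc n)
    have "iterated L 0 n (T n) = iterated L 0 n (y n) + iterated L 0 (Suc n) (T (Suc n))"
      by (subst T_step) (simp add: iterated_Suc linear_simps(1)[OF it_lin] del: iterated.simps(2))
    then show ?case using Suc by (simp add: add.assoc del: iterated.simps(2))
  qed simp
  have "f n (T 0) \<ge> real n" for n
  proof -
    define s where "s = (\<Sum>j<n. iterated L 0 j (y j))"
    define t where "t = iterated L 0 (Suc n) (T (Suc n))"
    have eq: "iterated L 0 n (y n) = T 0 + (- s) + (- t)"
      using expand[of "Suc n"] by (simp add: s_def t_def del: iterated.simps(2))
    have "f n (iterated L 0 n (y n)) \<le> f n (T 0) + f n (- s) + f n t"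
      unfolding eq using f_add[of n "T 0 + - s" "- t"] f_add[of n "T 0" "- s"] f_minus[of n t] by simp
    moreover have "f n t \<le> 2 * \<bar>C n\<bar>"
    proof -
      have "f n t \<le> C n * norm (T (Suc n))" unfolding t_def by (rule bounded)
      also have "\<dots> \<le> \<bar>C n\<bar> * 2" by (intro mult_mono T_norm) auto
      finally show ?thesis by simp
    qed
    ultimately show ?thesis using y[of n] by (simp add: good_def s_def)
  qed
  then show ?thesis by blast
qed

text \<open>Closedness at 0 suffices by linearity. Baire yields approximations \<open>v\<close> of
  \<open>x\<close> with \<open>D v\<close> under control; correcting the error repeatedly writes
  \<open>D x\<close> as a series dominated by a geometric one.\<close>

lemma closed_graph_bounded:
  fixes D :: "'a::banach \<Rightarrow> 'b::banach"
  assumes lin: "linear D"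
    and closed: "\<And>x s. x \<longlonglongrightarrow> 0 \<Longrightarrow> (\<lambda>n. D (x n)) \<longlonglongrightarrow> s \<Longrightarrow> s = 0"
  shows "bounded_linear D"
proof -
  interpret linear D by (rule lin)
  define A where "A n = {x. norm (D x) \<le> real n}" for n
  have "\<exists>n. interior (closure (A n)) \<noteq> {}"
  proof (rule ccontr)
    assume neg: "\<nexists>n. interior (closure (A n)) \<noteq> {}"
    have "closure (\<Inter>n. - closure (A n)) = UNIV"
      using neg by (intro Baire_complete) (auto simp: closure_complement)
    then have "(\<Inter>n. - closure (A n)) \<noteq> {}" by (metis closure_empty UNIV_not_empty)
    then obtain x where "x \<in> (\<Inter>n. - closure (A n))" by blast
    then have "x \<notin> A (nat \<lceil>norm (D x)\<rceil>)" using closure_subset by blast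
    then show False by (simp add: A_def of_nat_ceiling)
  qed
  then obtain N a where "a \<in> interior (closure (A N))" by blast
  then obtain e where e: "e > 0" "cball a e \<subseteq> closure (A N)"
    by (meson mem_interior_cball)
  \<comment> \<open>Subtracting \<open>a\<close> and rescaling turns the ball around \<open>a\<close> into approximate solvability.\<close>
  define K where "K = 2 * real N / e"
  have K: "K \<ge> 0" using e by (simp add: K_def)
  have approx: "\<exists>v. norm (x - v) \<le> \<delta> \<and> norm (D v) \<le> K * norm x" if \<delta>: "\<delta> > 0" for x \<delta>
  proof (cases "x = 0")
    case True
    then show ?thesis using \<delta> by (intro exI[of _ 0]) (simp add: zero)
  next
    case False
    define c where "c = e / norm x"
    have c: "c > 0" using False e by (simp add: c_def)
    have near: "\<exists>v\<in>A N. dist v b < c * \<delta> / 2" if "b \<in> cball a e" for b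
      using that e(2) c \<delta> by (meson closure_approachable half_gt_zero mult_pos_pos subsetD)
    have "a + c *\<^sub>R x \<in> cball a e" "a \<in> cball a e" using e False by (auto simp: c_def dist_norm)
    then obtain v v' where v: "v \<in> A N" "dist v (a + c *\<^sub>R x) < c * \<delta> / 2"
      "v' \<in> A N" "dist v' a < c * \<delta> / 2" using near by meson
    have "norm (c *\<^sub>R x - (v - v')) \<le> c * \<delta>"
    proof -
      have "c *\<^sub>R x - (v - v') = (v' - a) - (v - (a + c *\<^sub>R x))" by simp
      also have "norm \<dots> \<le> norm (v' - a) + norm (v - (a + c *\<^sub>R x))" by (rule norm_triangle_ineq4)
      finally show ?thesis using v by (simp add: dist_norm)
    qed
    moreover have "x - (1/c) *\<^sub>R (v - v') = (1/c) *\<^sub>R (c *\<^sub>R x - (v - v'))"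
      using c by (simp add: scaleR_diff_right)
    then have "norm (x - (1/c) *\<^sub>R (v - v')) = norm (c *\<^sub>R x - (v - v')) / c"
      using c by (simp only: norm_scaleR) simp
    ultimately have "norm (x - (1/c) *\<^sub>R (v - v')) \<le> \<delta>"
      using c by (simp only: divide_le_eq) (simp add: mult.commute)
    moreover have "norm (D ((1/c) *\<^sub>R (v - v'))) \<le> K * norm x"
    proof -
      have "norm (D v - D v') \<le> 2 * N"
        using v(1,3) norm_triangle_ineq4[of "D v" "D v'"] by (simp add: A_def)
      then have "(1/c) * norm (D v - D v') \<le> (1/c) * (2 * N)" using c by (intro mult_left_mono) auto
      also have "\<dots> = K * norm x" by (simp add: K_def c_def)
      finally show ?thesis using c by (simp only: scale diff norm_scaleR) simp
    qed
    ultimately show ?thesis by blast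
  qed
  show ?thesis
  proof (rule bounded_linear_intro[where K = "2 * K"])
    fix x :: 'a
    show "norm (D x) \<le> norm x * (2 * K)"
    proof (cases "x = 0")
      case True
      then show ?thesis by (simp add: zero)
    next
      case False
      define r where "r n = (1/2) ^ n * norm x" for n :: nat
      have r: "r n > 0" for n using False by (simp add: r_def)
      obtain s where s: "norm (z - s z n) \<le> r (Suc n)" "norm (D (s z n)) \<le> K * norm z" for z n
      proof -
        have "\<forall>z n. \<exists>v. norm (z - v) \<le> r (Suc n) \<and> norm (D v) \<le> K * norm z"
          using approx[OF r] by blast
        then show thesis using that unfolding choice_iff by blast
      qed
      \<comment> \<open>The error left after \<open>n\<close> corrections. It tends to 0, so
        closedness identifies \<open>D x\<close> with the sum of the images of the
        corrections.\<close>
      define z where "z = rec_nat x (\<lambda>n z. z - s z n)"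
      have z: "z 0 = x" "z (Suc n) = z n - s (z n) n" for n by (simp_all add: z_def)
      have z_norm: "norm (z n) \<le> r n" for n
      proof (cases n)
        case 0
        then show ?thesis by (simp add: z r_def)
      next
        case (Suc k)
        then show ?thesis using s(1)[of "z k" k] by (simp add: z)
      qed
      have z_lim: "z \<longlonglongrightarrow> 0"
      proof (rule Lim_null_comparison)
        show "\<forall>\<^sub>F n in sequentially. norm (z n) \<le> r n" using z_norm by simp
        have "(\<lambda>n. (1/2) ^ n * norm x) \<longlonglongrightarrow> 0 * norm x"
          by (intro tendsto_intros LIMSEQ_realpow_zero) auto
        then show "r \<longlonglongrightarrow> 0" by (simp add: r_def[abs_def])
      qed
      define d where "d n = D (s (z n) n)" for n
      have d_norm: "norm (d n) \<le> (K * norm x) * (1/2) ^ n" for n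
      proof -
        have "norm (d n) \<le> K * norm (z n)" unfolding d_def by (rule s)
        also have "\<dots> \<le> K * r n" by (intro mult_left_mono z_norm K)
        finally show ?thesis by (simp add: r_def mult_ac)
      qed
      have geo: "summable (\<lambda>n. (K * norm x) * (1/2) ^ n)"
        by (intro summable_mult summable_geometric) simp
      have summ: "summable d" by (rule summable_comparison_test'[OF geo, of 0]) (rule d_norm)
      have partial: "D (z n) = D x - (\<Sum>k<n. d k)" for n
        by (induction n) (auto simp: z diff d_def)
      have "(\<lambda>n. D (z n)) \<longlonglongrightarrow> D x - suminf d"
        unfolding partial using summ by (intro tendsto_intros summable_LIMSEQ)
      from closed[OF z_lim this] have "D x = suminf d" by simp
      then have "norm (D x) \<le> (\<Sum>n. (K * norm x) * (1/2) ^ n)"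
        using norm_suminf_le[OF d_norm geo] by simp
      also have "\<dots> = (K * norm x) * 2"
        by (subst suminf_mult) (auto simp: suminf_geometric intro: summable_geometric)
      finally show ?thesis by (simp add: mult_ac)
    qed
  qed (simp_all add: add scale)
qed

section \<open>Derivations of commutative Banach algebras\<close>

lemma clinear_simps:
  assumes "clinear f"
  shows "f (x + y) = f x + f y" "f (c *\<^sub>C x) = c *\<^sub>C f x" "f 0 = 0" "f (x - y) = f x - f y" "f (- x) = - f x"
proof -
  interpret Vector_Spaces.linear scaleC scaleC f by (rule assms)
  show "f (x + y) = f x + f y" "f (c *\<^sub>C x) = c *\<^sub>C f x" "f 0 = 0" "f (x - y) = f x - f y" "f (- x) = - f x"
    by (rule add scale zero diff neg)+
qed

lemma mult_linear_functional_simps: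
  assumes "mult_linear_functional \<phi>"
  shows "\<phi> (x + y) = \<phi> x + \<phi> y" "\<phi> (c *\<^sub>C x) = c * \<phi> x" "\<phi> 0 = 0" "\<phi> (x - y) = \<phi> x - \<phi> y"
    "\<phi> (- x) = - \<phi> x" "\<phi> (x * y) = \<phi> x * \<phi> y" "\<phi> (r *\<^sub>R x) = of_real r * \<phi> x"
  using assms clinear_simps[of \<phi>]
  by (simp_all add: mult_linear_functional_def scaleC_complex_def scaleR_scaleC)

text \<open>Otherwise a multiple \<open>y\<close> of \<open>x\<close> has norm below 1 and
  \<open>\<phi> y = 1\<close>; applying \<phi> to \<open>g = y + g * y\<close> gives
  \<open>\<phi> g = 1 + \<phi> g\<close>.\<close>

lemma mult_linear_functional_norm_le:
  assumes "mult_linear_functional \<phi>"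
  shows "cmod (\<phi> x) \<le> norm x"
proof (rule ccontr)
  assume neg: "\<not> cmod (\<phi> x) \<le> norm x"
  then have nz: "\<phi> x \<noteq> 0" using norm_ge_zero[of x] by (metis norm_zero)
  define y where "y = inverse (\<phi> x) *\<^sub>C x"
  have "norm y = norm x / cmod (\<phi> x)"
    by (simp add: y_def norm_scaleC norm_inverse divide_inverse mult.commute)
  then have "norm y < 1" using neg nz by (simp add: divide_less_eq)
  then obtain g where g: "g = y + g * y" by (rule left_quasi_inverse)
  have "\<phi> y = 1" using nz by (simp add: y_def mult_linear_functional_simps[OF assms])
  then have "\<phi> g = 1 + \<phi> g"
    using arg_cong[OF g, of \<phi>] by (simp add: mult_linear_functional_simps[OF assms])
  then show False by simp
qed

lemma mult_linear_functional_bounded_linear: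
  assumes "mult_linear_functional \<phi>"
  shows "bounded_linear \<phi>"
  by (rule bounded_linear_intro[where K = 1])
    (simp_all add: mult_linear_functional_simps[OF assms] mult_linear_functional_norm_le[OF assms]
      scaleR_conv_of_real)

lemma closure_nonzero_set:
  fixes f :: "'a::real_normed_vector \<Rightarrow> 'b::real_normed_vector"
  assumes "bounded_linear f" "f v \<noteq> 0"
  shows "closure {x. f x \<noteq> 0} = UNIV"
proof -
  interpret bounded_linear f by (rule assms)
  have "\<exists>y\<in>{x. f x \<noteq> 0}. dist y x < e" if e: "e > 0" for x e
  proof (cases "f x = 0")
    case True
    have v: "norm v > 0" using assms(2) zero by auto
    have "f (x + (e / (2 * norm v)) *\<^sub>R v) \<noteq> 0"
      using True assms(2) e v by (simp add: add scale)
    moreover have "dist (x + (e / (2 * norm v)) *\<^sub>R v) x < e"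
      using e v by (simp add: dist_norm)
    ultimately show ?thesis by blast
  next
    case False
    then show ?thesis using e by (intro bexI[of _ x]) auto
  qed
  then show ?thesis using closure_approachable by blast
qed

text \<open>Baire category: countably many proper closed subspaces, the kernels of
  \<open>\<phi> m\<close> and of \<open>\<phi> m - \<phi> n\<close>, do not cover the space. The
  diagonal pairs encode the first kind.\<close>

lemma distinct_functionals_separated:
  fixes \<phi> :: "nat \<Rightarrow> 'a::complex_banach_algebra \<Rightarrow> complex"
  assumes mlf: "\<And>n. mult_linear_functional (\<phi> n)" and "inj \<phi>" and nz: "\<And>n. \<exists>x. \<phi> n x \<noteq> 0"
  obtains x where "\<And>n. \<phi> n x \<noteq> 0" "\<And>m n. m \<noteq> n \<Longrightarrow> \<phi> m x \<noteq> \<phi> n x"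
proof -
  define g where "g k x = (case prod_decode k of (m, n) \<Rightarrow> \<phi> m x - (if m = n then 0 else \<phi> n x))" for k x
  have lin: "bounded_linear (g k)" for k
  proof -
    obtain m n where k: "prod_decode k = (m, n)" by fastforce
    have "g k = (\<lambda>x. \<phi> m x - (if m = n then 0 else \<phi> n x))"
      by (simp add: g_def k fun_eq_iff)
    then show ?thesis
      using mult_linear_functional_bounded_linear[OF mlf]
      by (cases "m = n") (auto intro: bounded_linear_sub)
  qed
  have ne: "\<exists>v. g k v \<noteq> 0" for k
  proof -
    obtain m n where k: "prod_decode k = (m, n)" by fastforce
    show ?thesis
    proof (cases "m = n")
      case True
      then show ?thesis using nz by (simp add: g_def k)
    next
      case False
      then have "\<phi> m \<noteq> \<phi> n" using \<open>inj \<phi>\<close> by (auto dest: injD)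
      then show ?thesis using False by (auto simp: g_def k fun_eq_iff)
    qed
  qed
  have "closure (\<Inter>k. {x. g k x \<noteq> 0}) = UNIV"
  proof (rule Baire_complete)
    show "open {x. g k x \<noteq> 0}" for k
      by (intro open_Collect_neq continuous_intros linear_continuous_on lin)
    show "closure {x. g k x \<noteq> 0} = UNIV" for k
      using ne[of k] closure_nonzero_set[OF lin] by blast
  qed
  then have "(\<Inter>k. {x. g k x \<noteq> 0}) \<noteq> {}" by (metis closure_empty UNIV_not_empty)
  then obtain x where x: "g k x \<noteq> 0" for k by blast
  show thesis
  proof
    show "\<phi> n x \<noteq> 0" for n using x[of "prod_encode (n, n)"] by (simp add: g_def)
    show "\<phi> m x \<noteq> \<phi> n x" if "m \<noteq> n" for m n
      using x[of "prod_encode (m, n)"] that by (simp add: g_def)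
  qed
qed

text \<open>Point separation by multiplicative functionals is semisimplicity in the form that the
  centre will supply.\<close>

locale separated_derivation =
  fixes D :: "'a::complex_banach_algebra \<Rightarrow> 'a"
  assumes comm: "\<And>x y :: 'a. x * y = y * x"
    and sep: "\<And>x :: 'a. (\<And>\<phi>. mult_linear_functional \<phi> \<Longrightarrow> \<phi> x = 0) \<Longrightarrow> x = 0"
    and clin: "clinear D"
    and der: "\<And>x y. D (x * y) = D x * y + x * D y"
begin

lemmas D_simps = clinear_simps[OF clin]

lemma D_scaleR: "D (r *\<^sub>R x) = r *\<^sub>R D x"
  by (simp add: scaleR_scaleC D_simps)

definition unbounded_functionals :: "('a \<Rightarrow> complex) set" where
  "unbounded_functionals =
    {\<phi>. mult_linear_functional \<phi> \<and> (\<forall>K. \<exists>x. cmod (\<phi> (D x)) > K * norm x)}"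

text \<open>An infinite sequence of such functionals would produce a gliding hump: multiplication by
  \<open>e k\<close> switches off the \<open>k\<close>-th functional alone, and the resulting
  \<open>x\<close> has \<open>cmod (\<phi> n (D x)) \<ge> real n\<close> for all \<open>n\<close>,
  although each \<open>\<phi> n\<close> is contractive.\<close>

lemma finite_unbounded_functionals: "finite unbounded_functionals"
proof (rule ccontr)
  assume "infinite unbounded_functionals"
  then obtain \<phi> :: "nat \<Rightarrow> 'a \<Rightarrow> complex" where inj: "inj \<phi>" and ran: "range \<phi> \<subseteq> unbounded_functionals"
    using infinite_countable_subset by blast
  have mlf: "mult_linear_functional (\<phi> n)" for n using ran by (auto simp: unbounded_functionals_def)
  note \<phi>_simps = mult_linear_functional_simps[OF mlf]
  have unb: "\<exists>x. cmod (\<phi> n (D x)) > K * norm x" for n K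
    using ran by (auto simp: unbounded_functionals_def)
  have nz: "\<exists>x. \<phi> n x \<noteq> 0" for n
    using unb[of 0 n] by (metis mult_zero_left norm_zero less_irrefl)
  obtain x0 where x0: "\<And>n. \<phi> n x0 \<noteq> 0" "\<And>m n. m \<noteq> n \<Longrightarrow> \<phi> m x0 \<noteq> \<phi> n x0"
    using distinct_functionals_separated[OF mlf inj nz] by blast
  \<comment> \<open>In spirit \<open>x0 - \<phi> k x0\<close>, with a factor \<open>x0\<close> to
    stay inside an algebra without identity.\<close>
  define e' where "e' k = x0 * x0 - \<phi> k x0 *\<^sub>C x0" for k
  define e where "e k = (1 / (1 + norm (e' k))) *\<^sub>R e' k" for k
  have e_norm: "norm (e k) \<le> 1" for k
    by (simp add: e_def divide_le_eq_1 add_pos_nonneg)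
  have e'_val: "\<phi> n (e' k) = \<phi> n x0 * (\<phi> n x0 - \<phi> k x0)" for n k
    by (simp add: e'_def \<phi>_simps algebra_simps)
  have e_zero: "\<phi> n (e k) = 0 \<longleftrightarrow> n = k" for n k
  proof -
    have "1 + norm (e' k) \<noteq> 0" by (metis add_pos_nonneg less_irrefl norm_ge_zero zero_less_one)
    then have "\<phi> n (e k) = 0 \<longleftrightarrow> \<phi> n (e' k) = 0"
      by (simp only: e_def \<phi>_simps mult_eq_0_iff of_real_eq_0_iff) simp
    then show ?thesis using x0(1)[of n] x0(2)[of n k] by (auto simp: e'_val)
  qed
  define L where "L k x = e k * x" for k x
  have L_lin: "bounded_linear (L k)" for k
    unfolding L_def[abs_def] by (rule bounded_linear_mult_right)
  \<comment> \<open>By the Leibniz rule the unbounded part is multiplied by the values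
    \<open>\<phi> n (e j)\<close>: their product is nonzero up to stage \<open>n\<close> and zero
    once the factor \<open>j = n\<close> occurs.\<close>
  have expand: "\<exists>a. \<forall>x. \<phi> n (D (iterated L 0 k x)) = a * \<phi> n x + (\<Prod>j<k. \<phi> n (e j)) * \<phi> n (D x)" for n k
  proof (induction k)
    case 0
    show ?case by (intro exI[of _ 0]) simp
  next
    case (Suc k)
    then obtain a where a: "\<phi> n (D (iterated L 0 k x)) = a * \<phi> n x + (\<Prod>j<k. \<phi> n (e j)) * \<phi> n (D x)" for x
      by blast
    have it: "iterated L 0 (Suc k) x = iterated L 0 k (e k * x)" for x
      by (simp add: iterated_Suc L_def[of k x] del: iterated.simps(2))
    show ?case
      by (intro exI[of _ "a * \<phi> n (e k) + (\<Prod>j<k. \<phi> n (e j)) * \<phi> n (D (e k))"])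
        (simp add: it a der \<phi>_simps algebra_simps del: iterated.simps(2))
  qed
  then obtain a where a: "\<phi> n (D (iterated L 0 k x)) = a n k * \<phi> n x + (\<Prod>j<k. \<phi> n (e j)) * \<phi> n (D x)" for n k x
    by metis
  have "\<exists>x. \<forall>n. cmod (\<phi> n (D x)) \<ge> real n"
  proof (rule gliding_hump[where L = L and C = "\<lambda>n. cmod (a n (Suc n))"])
    show "norm (L n x) \<le> norm x" for n x
      using norm_mult_ineq[of "e n" x] mult_right_mono[OF e_norm[of n] norm_ge_zero[of x]] by (simp add: L_def)
    show "cmod (\<phi> n (D (iterated L 0 (Suc n) x))) \<le> cmod (a n (Suc n)) * norm x" for n x
    proof -
      have "(\<Prod>j<Suc n. \<phi> n (e j)) = 0" by (simp add: e_zero)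
      then have "\<phi> n (D (iterated L 0 (Suc n) x)) = a n (Suc n) * \<phi> n x"
        unfolding a[of n "Suc n"] by (simp only: mult_zero_left add_0_right)
      then show ?thesis
        using mult_left_mono[OF mult_linear_functional_norm_le[OF mlf]] by (simp only: norm_mult) simp
    qed
    show "\<exists>x. norm x \<le> \<epsilon> \<and> K \<le> cmod (\<phi> n (D (iterated L 0 n x)))" if \<epsilon>: "\<epsilon> > 0" for n K \<epsilon>
    proof -
      define b where "b = (\<Prod>j<n. \<phi> n (e j))"
      have b: "cmod b > 0" by (simp add: b_def e_zero)
      define K' where "K' = (K + cmod (a n n) * \<epsilon>) / (cmod b * \<epsilon>)"
      obtain v where v: "cmod (\<phi> n (D v)) > K' * norm v" using unb by blast
      then have "v \<noteq> 0" by (auto simp: D_simps \<phi>_simps)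
      define x where "x = (\<epsilon> / norm v) *\<^sub>R v"
      have nx: "norm x = \<epsilon>" using \<epsilon> \<open>v \<noteq> 0\<close> by (simp add: x_def)
      have "cmod (\<phi> n (D x)) = \<epsilon> / norm v * cmod (\<phi> n (D v))"
        using \<epsilon> by (simp add: x_def D_scaleR \<phi>_simps norm_mult norm_divide)
      also have "\<dots> \<ge> \<epsilon> / norm v * (K' * norm v)"
        using v \<epsilon> by (intro mult_left_mono) auto
      finally have "cmod (\<phi> n (D x)) \<ge> K' * \<epsilon>" using \<open>v \<noteq> 0\<close> by (simp add: mult.commute)
      then have "cmod b * cmod (\<phi> n (D x)) \<ge> cmod b * (K' * \<epsilon>)" using b by (intro mult_left_mono) auto
      also have "cmod b * (K' * \<epsilon>) = K + cmod (a n n) * \<epsilon>" using b \<epsilon> by (simp add: K'_def)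
      finally have *: "cmod (b * \<phi> n (D x)) \<ge> K + cmod (a n n) * \<epsilon>" by (simp add: norm_mult)
      have "cmod (a n n * \<phi> n x) \<le> cmod (a n n) * \<epsilon>"
        using mult_linear_functional_norm_le[OF mlf, of n x] nx by (simp add: norm_mult mult_left_mono)
      moreover have "cmod (b * \<phi> n (D x)) \<le> cmod (\<phi> n (D (iterated L 0 n x))) + cmod (a n n * \<phi> n x)"
        unfolding a b_def[symmetric] using norm_triangle_ineq4[of "a n n * \<phi> n x + b * \<phi> n (D x)" "a n n * \<phi> n x"] by simp
      ultimately show ?thesis using * nx by (intro exI[of _ x]) simp
    qed
  qed (use L_lin in \<open>auto simp: D_simps \<phi>_simps norm_triangle_ineq\<close>)
  then obtain x where x: "cmod (\<phi> n (D x)) \<ge> real n" for n by blast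
  then have "real n \<le> norm (D x)" for n
    using mult_linear_functional_norm_le[OF mlf] order_trans by blast
  then show False using reals_Archimedean2 not_less by blast
qed

lemma eqI: "(\<And>\<phi>. mult_linear_functional \<phi> \<Longrightarrow> \<phi> x = \<phi> y) \<Longrightarrow> x = (y :: 'a)"
  using sep[of "x - y"] by (simp add: mult_linear_functional_simps)

lemma D_idempotent:
  assumes "e * e = e" shows "D e = 0"
proof -
  have *: "D e = e * D e + e * D e" using der[of e e] assms comm by simp
  then have "e * D e = e * (e * D e + e * D e)" by simp
  then have "e * D e = e * D e + e * D e" using assms by (simp add: distrib_left flip: mult.assoc)
  then show ?thesis using * by simp
qed

text \<open>A functional \<open>\<psi>\<close> with \<open>\<psi> \<circ> D\<close> unbounded that does not vanish on the common kernel of the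
  others would have a supporting idempotent \<open>e\<close>; but \<open>D e = 0\<close> forces \<open>\<psi> \<circ> D = 0\<close>.\<close>

lemma bounded_functionals_separate:
  assumes x: "\<And>\<phi>. mult_linear_functional \<phi> \<Longrightarrow> \<phi> \<notin> unbounded_functionals \<Longrightarrow> \<phi> x = 0"
  shows "x = 0"
proof (rule sep)
  fix \<psi> :: "'a \<Rightarrow> complex" assume \<psi>: "mult_linear_functional \<psi>"
  note \<psi>_simps = mult_linear_functional_simps[OF \<psi>]
  show "\<psi> x = 0"
  proof (rule ccontr)
    assume nz: "\<psi> x \<noteq> 0"
    then have \<psi>F: "\<psi> \<in> unbounded_functionals" using x \<psi> by blast
    have "\<exists>y. \<psi> y \<noteq> 0 \<and> (\<forall>\<phi>. mult_linear_functional \<phi> \<and> \<phi> \<notin> unbounded_functionals \<longrightarrow> \<phi> y = 0)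
        \<and> (\<forall>\<phi>\<in>G. \<phi> y = 0)"
      if "finite G" "G \<subseteq> unbounded_functionals - {\<psi>}" for G
      using that
    proof (induction rule: finite_induct)
      case empty
      then show ?case using nz x by (intro exI[of _ x]) blast
    next
      case (insert \<xi> G)
      then obtain y where y: "\<psi> y \<noteq> 0"
        "\<And>\<phi>. mult_linear_functional \<phi> \<Longrightarrow> \<phi> \<notin> unbounded_functionals \<Longrightarrow> \<phi> y = 0"
        "\<And>\<phi>. \<phi> \<in> G \<Longrightarrow> \<phi> y = 0" by blast
      have \<xi>: "mult_linear_functional \<xi>" "\<xi> \<noteq> \<psi>"
        using insert.prems by (auto simp: unbounded_functionals_def)
      then obtain v where v: "\<xi> v \<noteq> \<psi> v" by (auto simp: fun_eq_iff)
      \<comment> \<open>Killed by \<xi> but not by \<psi>; multiplying \<open>y\<close> by it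
        removes one more functional and keeps the earlier zeros.\<close>
      define a where "a = v * x - \<xi> v *\<^sub>C x"
      have "\<xi> a = 0" by (simp add: a_def mult_linear_functional_simps[OF \<xi>(1)])
      moreover have "\<psi> a \<noteq> 0" using v nz by (simp add: a_def \<psi>_simps)
      ultimately show ?case
        using y insert.prems \<xi>(1) \<psi>
        by (intro exI[of _ "a * y"])
          (auto simp: mult_linear_functional_simps unbounded_functionals_def)
    qed
    from this[of "unbounded_functionals - {\<psi>}"] obtain y where y: "\<psi> y \<noteq> 0"
      "\<And>\<phi>. mult_linear_functional \<phi> \<Longrightarrow> \<phi> \<noteq> \<psi> \<Longrightarrow> \<phi> y = 0"
      using finite_unbounded_functionals by blast
    define e where "e = inverse (\<psi> y) *\<^sub>C y"
    have e: "\<phi> e = (if \<phi> = \<psi> then 1 else 0)" if "mult_linear_functional \<phi>" for \<phi>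
      using y that by (simp add: e_def mult_linear_functional_simps)
    have "e * e = e" by (rule eqI) (simp add: e mult_linear_functional_simps)
    then have De: "D e = 0" by (rule D_idempotent)
    have "\<psi> (D z) = 0" for z
    proof -
      have "e * z = \<psi> z *\<^sub>C e" by (rule eqI) (simp add: e mult_linear_functional_simps)
      then have "D (e * z) = 0" by (simp add: D_simps De)
      then have "e * D z = 0" by (simp add: der De)
      then have "\<psi> (e * D z) = 0" by (simp add: \<psi>_simps)
      then show ?thesis by (simp add: \<psi>_simps e \<psi>)
    qed
    then show False using \<psi>F by (auto simp: unbounded_functionals_def dest: spec[of _ 0])
  qed
qed

text \<open>A limit of \<open>D (x n)\<close> along a null sequence is annihilated by every \<phi>
  whose composition with \<open>D\<close> is bounded, and these functionals separate points.\<close>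

lemma bounded_linear_D: "bounded_linear D"
proof (rule closed_graph_bounded)
  show "linear D" by (rule linearI) (simp_all add: D_simps D_scaleR)
  fix x s assume x: "x \<longlonglongrightarrow> 0" "(\<lambda>n. D (x n)) \<longlonglongrightarrow> s"
  show "s = 0"
  proof (rule bounded_functionals_separate)
    fix \<phi> :: "'a \<Rightarrow> complex"
    assume \<phi>: "mult_linear_functional \<phi>" "\<phi> \<notin> unbounded_functionals"
    then obtain K where K: "cmod (\<phi> (D y)) \<le> K * norm y" for y
      by (auto simp: unbounded_functionals_def not_less)
    have "(\<lambda>n. \<phi> (D (x n))) \<longlonglongrightarrow> \<phi> s"
      by (rule bounded_linear.tendsto[OF mult_linear_functional_bounded_linear[OF \<phi>(1)] x(2)])
    moreover have "(\<lambda>n. \<phi> (D (x n))) \<longlonglongrightarrow> 0"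
    proof (rule Lim_null_comparison)
      show "\<forall>\<^sub>F n in sequentially. norm (\<phi> (D (x n))) \<le> K * norm (x n)" using K by simp
      have "(\<lambda>n. K * norm (x n)) \<longlonglongrightarrow> K * norm (0::'a)" by (intro tendsto_intros x)
      then show "(\<lambda>n. K * norm (x n)) \<longlonglongrightarrow> 0" by simp
    qed
    ultimately show "\<phi> s = 0" by (rule LIMSEQ_unique)
  qed
qed

section \<open>Divided powers of \<open>D\<close> and the Singer--Wermer argument\<close>

definition E :: "nat \<Rightarrow> 'a \<Rightarrow> 'a" where
  "E n x = (1 / fact n) *\<^sub>R (D ^^ n) x"

lemma E_Suc: "real (Suc n) *\<^sub>R E (Suc n) x = D (E n x)"
  by (simp add: E_def D_scaleR)

lemma D_sum: "D (sum f S) = (\<Sum>i\<in>S. D (f i))"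
  by (induction S rule: infinite_finite_induct) (simp_all add: D_simps)

lemma E_leibniz: "E n (x * y) = (\<Sum>k\<le>n. E k x * E (n - k) y)"
proof (induction n)
  case 0
  show ?case by (simp add: E_def)
next
  case (Suc n)
  define t where "t k = E k x * E (Suc n - k) y" for k
  have "real (Suc n) *\<^sub>R E (Suc n) (x * y) = D (\<Sum>k\<le>n. E k x * E (n - k) y)"
    by (simp only: E_Suc Suc)
  also have "\<dots> = (\<Sum>k\<le>n. D (E k x) * E (n - k) y) + (\<Sum>k\<le>n. E k x * D (E (n - k) y))"
    by (simp add: D_sum der sum.distrib)
  also have "(\<Sum>k\<le>n. D (E k x) * E (n - k) y) = (\<Sum>k\<le>n. real (Suc k) *\<^sub>R t (Suc k))"
    by (simp add: t_def flip: E_Suc)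
  also have "\<dots> = (\<Sum>k\<le>Suc n. real k *\<^sub>R t k)"
    by (subst sum.atMost_Suc_shift) simp
  also have "(\<Sum>k\<le>n. E k x * D (E (n - k) y)) = (\<Sum>k\<le>n. real (Suc n - k) *\<^sub>R t k)"
    by (intro sum.cong) (auto simp: t_def Suc_diff_le simp flip: E_Suc)
  also have "\<dots> = (\<Sum>k\<le>Suc n. real (Suc n - k) *\<^sub>R t k)" by simp
  \<comment> \<open>The two sums weight \<open>t k\<close> by \<open>k\<close> and
    \<open>Suc n - k\<close>, which add up to \<open>Suc n\<close>.\<close>
  also have "(\<Sum>k\<le>Suc n. real k *\<^sub>R t k) + (\<Sum>k\<le>Suc n. real (Suc n - k) *\<^sub>R t k) =
      (\<Sum>k\<le>Suc n. real (Suc n) *\<^sub>R t k)"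
    unfolding sum.distrib[symmetric] scaleR_left_distrib[symmetric]
    by (intro sum.cong) auto
  finally have "real (Suc n) *\<^sub>R E (Suc n) (x * y) = real (Suc n) *\<^sub>R (\<Sum>k\<le>Suc n. t k)"
    by (simp only: scaleR_sum_right)
  then show ?case unfolding t_def by (simp only: scaleR_cancel_left) simp
qed

text \<open>The power with exponent \<open>Suc n\<close>: without an identity, counting starts at
  the first power.\<close>

primrec pow :: "'a \<Rightarrow> nat \<Rightarrow> 'a" where
  "pow x 0 = x"
| "pow x (Suc n) = x * pow x n"

text \<open>\<open>pow x n\<close> has \<open>Suc n\<close> factors, each annihilated by \<phi>.
  Lower orders leave some factor undifferentiated; at order \<open>Suc n\<close> only
  differentiating every factor exactly once survives, and the factorial in \<open>E\<close> cancels
  the number of ways.\<close>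

lemma E_pow:
  assumes \<phi>: "mult_linear_functional \<phi>" and x: "\<phi> x = 0"
  shows "(k \<le> n \<longrightarrow> \<phi> (E k (pow x n)) = 0) \<and> \<phi> (E (Suc n) (pow x n)) = \<phi> (D x) ^ Suc n"
proof (induction n arbitrary: k)
  case 0
  show ?case by (simp add: E_def x)
next
  case (Suc n)
  have sum: "\<phi> (sum f S) = (\<Sum>i\<in>S. \<phi> (f i))" for f and S :: "nat set"
    by (induction S rule: infinite_finite_induct) (simp_all add: mult_linear_functional_simps[OF \<phi>])
  have ex: "\<phi> (E k (pow x (Suc n))) = (\<Sum>i\<le>k. \<phi> (E i x) * \<phi> (E (k - i) (pow x n)))" for k
    by (simp add: E_leibniz sum mult_linear_functional_simps[OF \<phi>])
  have E0: "\<phi> (E 0 x) = 0" by (simp add: E_def x)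
  have E1: "E (Suc 0) x = D x" by (simp add: E_def)
  have "\<phi> (E k (pow x (Suc n))) = 0" if "k \<le> Suc n"
    unfolding ex
  proof (rule sum.neutral, safe)
    fix i assume "i \<le> k"
    show "\<phi> (E i x) * \<phi> (E (k - i) (pow x n)) = 0"
      using Suc[of "k - i"] that E0 by (cases i) auto
  qed
  moreover have "\<phi> (E (Suc (Suc n)) (pow x (Suc n))) = \<phi> (D x) ^ Suc (Suc n)"
  proof -
    have "\<phi> (E (Suc (Suc n)) (pow x (Suc n))) =
        (\<Sum>i\<in>{Suc 0}. \<phi> (E i x) * \<phi> (E (Suc (Suc n) - i) (pow x n)))"
      unfolding ex
    proof (rule sum.mono_neutral_right; (rule ballI)?)
      fix i assume "i \<in> {..Suc (Suc n)} - {Suc 0}"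
      then show "\<phi> (E i x) * \<phi> (E (Suc (Suc n) - i) (pow x n)) = 0"
        using Suc[of "Suc (Suc n) - i"] E0 by (cases "i = 0") auto
    qed auto
    then show ?thesis using Suc by (simp add: E1)
  qed
  ultimately show ?case by blast
qed

text \<open>By \<open>E_pow\<close> the \<open>Suc n\<close>-th power of
  \<open>cmod (\<phi> (D x))\<close> is at most \<open>(B * norm x) ^ Suc n / fact (Suc n)\<close>.
  A nonzero value contradicts this for large \<open>n\<close>, since factorials outgrow
  powers.\<close>

lemma functional_D_zero_on_kernel:
  assumes \<phi>: "mult_linear_functional \<phi>" and x: "\<phi> x = 0"
  shows "\<phi> (D x) = 0"
proof (rule ccontr)
  assume nz: "\<phi> (D x) \<noteq> 0"
  obtain B where B: "B > 0" "norm (D y) \<le> norm y * B" for y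
    using bounded_linear.pos_bounded[OF bounded_linear_D] by blast
  have D_pow: "norm ((D ^^ n) y) \<le> B ^ n * norm y" for n y
  proof (induction n)
    case (Suc n)
    have "norm ((D ^^ Suc n) y) \<le> norm ((D ^^ n) y) * B" using B(2) by simp
    also have "\<dots> \<le> (B ^ n * norm y) * B" using Suc B(1) by (intro mult_right_mono) auto
    finally show ?case by (simp add: mult_ac)
  qed simp
  have pow: "norm (pow x n) \<le> norm x ^ Suc n" for n
  proof (induction n)
    case (Suc n)
    then show ?case
      using order_trans[OF norm_mult_ineq mult_left_mono, of "pow x n" _ x] by simp
  qed simp
  define c where "c = B * norm x / cmod (\<phi> (D x))"
  have "1 \<le> inverse (fact (Suc n)) * c ^ Suc n" for n
  proof -
    have "cmod (\<phi> (D x)) ^ Suc n = cmod (\<phi> (E (Suc n) (pow x n)))"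
      using E_pow[OF \<phi> x] by (simp only: norm_power)
    also have "\<dots> \<le> norm (E (Suc n) (pow x n))" by (rule mult_linear_functional_norm_le[OF \<phi>])
    also have "\<dots> = inverse (fact (Suc n)) * norm ((D ^^ Suc n) (pow x n))"
      by (simp add: E_def divide_inverse del: fact_Suc funpow.simps)
    also have "\<dots> \<le> inverse (fact (Suc n)) * (B ^ Suc n * norm (pow x n))"
      by (intro mult_left_mono D_pow) auto
    also have "\<dots> \<le> inverse (fact (Suc n)) * (B ^ Suc n * norm x ^ Suc n)"
      using B(1) by (intro mult_left_mono pow) auto
    also have "\<dots> = (inverse (fact (Suc n)) * c ^ Suc n) * cmod (\<phi> (D x)) ^ Suc n"
      using nz unfolding c_def power_mult_distrib power_divide by (simp del: power_Suc fact_Suc)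
    finally show ?thesis using nz by (simp del: power_Suc fact_Suc)
  qed
  moreover have "(\<lambda>n. inverse (fact (Suc n)) * c ^ Suc n) \<longlonglongrightarrow> 0"
    by (rule LIMSEQ_Suc[OF summable_LIMSEQ_zero[OF summable_exp]])
  ultimately have "1 \<le> (0 :: real)"
    by (intro tendsto_lowerbound[of _ 0 sequentially 1]) auto
  then show False by simp
qed

theorem D_eq_0: "D x = 0"
proof (rule sep)
  fix \<phi> :: "'a \<Rightarrow> complex" assume \<phi>: "mult_linear_functional \<phi>"
  note \<phi>_simps = mult_linear_functional_simps[OF \<phi>]
  \<comment> \<open>An element of the kernel of \<phi>; the Leibniz rule turns this into
    \<open>\<phi> x * \<phi> (D x) = 0\<close>, which settles the \<open>x\<close> off the
    kernel.\<close>
  have "\<phi> (D (x * x - \<phi> x *\<^sub>C x)) = 0"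
    by (rule functional_D_zero_on_kernel[OF \<phi>]) (simp add: \<phi>_simps)
  then have "\<phi> x * \<phi> (D x) = 0" by (simp add: D_simps der \<phi>_simps)
  then show "\<phi> (D x) = 0" using functional_D_zero_on_kernel[OF \<phi>, of x] by auto
qed

end

section \<open>The centre as a Banach algebra\<close>

text \<open>A type of its own, because \<open>separated_derivation\<close> concerns algebras that
  are whole types.\<close>

typedef (overloaded) ('a::complex_banach_algebra) center = "algebra_center :: 'a set"
  morphisms of_center to_center
  by (rule exI[of _ 0]) (simp add: algebra_center_def)

setup_lifting type_definition_center

lemma closed_algebra_center: "closed (algebra_center :: 'a::complex_banach_algebra set)"
proof -
  have eq: "algebra_center = (\<Inter>x. {z :: 'a. z * x = x * z})" by (auto simp: algebra_center_def)
  show ?thesis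
    unfolding eq by (intro closed_INT ballI closed_Collect_eq continuous_intros)
qed

instantiation center :: (complex_banach_algebra) real_normed_algebra
begin

lift_definition zero_center :: "'a center" is 0 by (simp add: algebra_center_def)
lift_definition plus_center :: "'a center \<Rightarrow> 'a center \<Rightarrow> 'a center" is "(+)"
  by (simp add: algebra_center_def algebra_simps)
lift_definition minus_center :: "'a center \<Rightarrow> 'a center \<Rightarrow> 'a center" is "(-)"
  by (simp add: algebra_center_def algebra_simps)
lift_definition uminus_center :: "'a center \<Rightarrow> 'a center" is uminus
  by (simp add: algebra_center_def)
lift_definition times_center :: "'a center \<Rightarrow> 'a center \<Rightarrow> 'a center" is "(*)"
proof -
  fix y z :: 'a assume "y \<in> algebra_center" "z \<in> algebra_center"
  then have c: "y * x = x * y" "z * x = x * z" for x by (simp_all add: algebra_center_def)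
  have "y * z * x = x * (y * z)" for x
    by (metis c mult.assoc)
  then show "y * z \<in> algebra_center" by (simp add: algebra_center_def)
qed
lift_definition scaleR_center :: "real \<Rightarrow> 'a center \<Rightarrow> 'a center" is scaleR
  by (simp add: algebra_center_def)
lift_definition norm_center :: "'a center \<Rightarrow> real" is norm .

definition sgn_center :: "'a center \<Rightarrow> 'a center" where
  "sgn_center x = inverse (norm x) *\<^sub>R x"
definition dist_center :: "'a center \<Rightarrow> 'a center \<Rightarrow> real" where
  "dist_center x y = norm (x - y)"
definition uniformity_center :: "('a center \<times> 'a center) filter" where
  "uniformity_center = (INF e\<in>{0<..}. principal {(x, y). dist x y < e})"
definition open_center :: "'a center set \<Rightarrow> bool" where
  "open_center U \<longleftrightarrow> (\<forall>x\<in>U. \<forall>\<^sub>F (x', y) in uniformity. x' = x \<longrightarrow> y \<in> U)"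

instance
proof
qed (rule sgn_center_def dist_center_def uniformity_center_def open_center_def |
  (transfer, simp add: algebra_simps norm_mult_ineq norm_triangle_ineq))+

end

instantiation center :: (complex_banach_algebra) complex_banach_algebra
begin

lift_definition scaleC_center :: "complex \<Rightarrow> 'a center \<Rightarrow> 'a center" is scaleC
  by (simp add: algebra_center_def scaleC_mult_left scaleC_mult_right)

lemma dist_of_center: "dist (of_center x) (of_center y) = dist x y"
  unfolding dist_norm by transfer simp

instance
proof
  fix X :: "nat \<Rightarrow> 'a center"
  assume "Cauchy X"
  then have "Cauchy (\<lambda>n. of_center (X n))"
    by (simp add: Cauchy_def dist_of_center)
  then obtain l where l: "(\<lambda>n. of_center (X n)) \<longlonglongrightarrow> l"
    using Cauchy_convergent convergent_def by blast
  have "l \<in> algebra_center"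
    using closed_sequentially[OF closed_algebra_center _ l] of_center by blast
  then have "of_center (to_center l) = l" by (rule to_center_inverse)
  then have "X \<longlonglongrightarrow> to_center l"
    using l by (simp add: lim_sequentially flip: dist_of_center)
  then show "convergent X" by (auto simp: convergent_def)
qed (transfer, rule scaleC_add_right scaleC_add_left scaleC_scaleC scaleC_one
   scaleR_scaleC norm_scaleC scaleC_mult_left scaleC_mult_right)+

end

section \<open>Centralizing Jordan derivations\<close>

lemma clinearI:
  assumes "\<And>x y. f (x + y) = f x + f y" "\<And>c x. f (c *\<^sub>C x) = c *\<^sub>C f x"
  shows "clinear f"
  by unfold_locales (rule assms)+

lemma algebra_centerD: "z \<in> algebra_center \<Longrightarrow> z * x = x * z"
  unfolding algebra_center_def by blast

text \<open>A nonzero central element avoids some maximal modular left ideal \<open>M\<close>, so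
  the scalar by which it acts on \<open>A / M\<close> is nonzero; on the centre this scalar is a
  multiplicative functional.\<close>

lemma center_separated:
  fixes x :: "'a::complex_banach_algebra center"
  assumes ss: "semisimple TYPE('a)"
    and vanish: "\<And>\<phi> :: 'a center \<Rightarrow> complex. mult_linear_functional \<phi> \<Longrightarrow> \<phi> x = 0"
  shows "x = 0"
proof (rule ccontr)
  assume "x \<noteq> 0"
  then have "of_center x \<noteq> 0" by transfer
  then obtain M where M: "max_modular M" "of_center x \<notin> M"
    using semisimple_notin_max_modular[OF ss] by blast
  interpret max_modular M by (rule M)
  have in_center: "of_center y \<in> algebra_center" for y :: "'a center" by (rule of_center)
  have "mult_linear_functional (\<lambda>y. char (of_center y))"
    unfolding mult_linear_functional_def
  proof (intro conjI allI clinearI)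
    fix y z :: "'a center" and c
    show "char (of_center (y + z)) = char (of_center y) + char (of_center z)"
      using in_center[of "y + z"] in_center by (simp add: plus_center.rep_eq char_add)
    show "char (of_center (y * z)) = char (of_center y) * char (of_center z)"
      using in_center[of "y * z"] in_center by (simp add: times_center.rep_eq char_mult)
    show "char (of_center (c *\<^sub>C y)) = c *\<^sub>C char (of_center y)"
      using in_center[of "c *\<^sub>C y"] in_center
      by (simp add: scaleC_center.rep_eq char_scale scaleC_complex_def)
  qed
  then have "char (of_center x) = 0" by (rule vanish)
  then show False using char_zero_imp[OF in_center] M(2) by blast
qed

lemma central_derivation_eq_0:
  fixes Q :: "'a::complex_banach_algebra \<Rightarrow> 'a"
  assumes ss: "semisimple TYPE('a)" and clin: "clinear Q"
    and Q_mult: "\<And>x y. Q (x * y) = Q x * y + x * Q y"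
    and central: "\<And>x y. Q x * y = y * Q x"
  shows "Q x = 0"
proof -
  note Q_simps = clinear_simps[OF clin]
  have Qc: "Q x \<in> algebra_center" for x using central by (simp add: algebra_center_def)
  define D where "D z = to_center (Q (of_center z))" for z
  have D: "of_center (D z) = Q (of_center z)" for z by (simp add: D_def to_center_inverse Qc)
  interpret separated_derivation D
  proof
    fix x y :: "'a center" and c
    show "x * y = y * x" by transfer (rule algebra_centerD)
    show "D (x + y) = D x + D y"
      by (simp add: D plus_center.rep_eq Q_simps flip: of_center_inject)
    show "D (c *\<^sub>C x) = c *\<^sub>C D x"
      by (simp add: D scaleC_center.rep_eq Q_simps flip: of_center_inject)
    show "D (x * y) = D x * y + x * D y"
      by (simp add: D plus_center.rep_eq times_center.rep_eq Q_mult flip: of_center_inject)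
    show "x = 0" if "\<And>\<phi>. mult_linear_functional \<phi> \<Longrightarrow> \<phi> x = 0"
      using center_separated[OF ss] that by blast
  qed
  have QQ: "Q (Q x) = 0" for x
    using D[of "to_center (Q x)"] D_eq_0 by (simp add: to_center_inverse Qc zero_center.rep_eq)
  \<comment> \<open>\<open>Q (Q (x * x)) = 0\<close> expanded by the Leibniz rule: second
    derivatives vanish, and the cross terms leave twice \<open>Q x * Q x\<close>.\<close>
  have "Q (Q x * x + x * Q x) = 2 *\<^sub>R (Q x * Q x)" by (simp add: Q_mult Q_simps QQ scaleR_2)
  then have "2 *\<^sub>R (Q x * Q x) = 0" using QQ[of "x * x"] by (simp only: Q_mult)
  then have sq: "Q x * Q x = 0" by simp
  show ?thesis
  proof (rule semisimple_imp_semiprime[OF ss])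
    fix y
    have "Q x * y * Q x = y * (Q x * Q x)" by (simp add: central[of x y] mult.assoc)
    then show "Q x * y * Q x = 0" by (simp add: sq)
  qed
qed

theorem centralizing_jordan_derivation_eq_0:
  fixes Q :: "'a::complex_banach_algebra \<Rightarrow> 'a"
  assumes ss: "semisimple TYPE('a)" and clin: "clinear Q"
    and jordan: "\<And>x. Q (x * x) = Q x * x + x * Q x"
    and cen: "\<And>x. Q x * x - x * Q x \<in> algebra_center"
  shows "Q x = 0"
proof -
  interpret jordan_derivation Q
  proof
    show "x = 0" if "x + x = 0" for x :: 'a
      using that by (metis scaleR_2 scaleR_eq_0_iff zero_neq_numeral)
    show "c = 0" if "\<And>x. c * x * c = 0" for c :: 'a
      by (rule semisimple_imp_semiprime[OF ss that])
  qed (simp_all add: clinear_simps[OF clin] jordan)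
  have "Q x * z = z * Q x" for x z
    by (rule centralizing_imp_central_range) (use cen in \<open>simp add: commutator_def algebra_center_def\<close>)
  then show ?thesis using central_derivation_eq_0[OF ss clin derivation] by blast
qed

section \<open>Jordan derivations for the Lau product\<close>

theorem theorem2p6:
  fixes u :: "'a::complex_banach_algebra"
    and \<theta> \<phi> \<gamma> \<eta>1 \<eta>2 :: "'b::complex_banach_algebra \<Rightarrow> complex"
  assumes "\<forall>a. a * u = a"
    and "semisimple TYPE('b)"
    and "nonzero_mult_linear_functional \<theta>"
    and "nonzero_mult_linear_functional \<phi>"
    and "nonzero_mult_linear_functional \<gamma>"
    and "nonzero_mult_linear_functional \<eta>1"
    and "nonzero_mult_linear_functional \<eta>2"
    and "\<theta> \<noteq> \<phi>"
  shows "{d \<in> DerJ \<theta> \<phi> \<gamma>. centralizing \<eta>1 \<eta>2 d} = {\<lambda>_ :: 'a \<times> 'b. 0}"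
proof (intro equalityI subsetI)
  note mlf = assms(3-7)[unfolded nonzero_mult_linear_functional_def, THEN conjunct1]
  note f_simps = mlf[THEN mult_linear_functional_simps(3)]
  have u: "a * u = a" for a using assms(1) by simp
  fix d :: "'a \<times> 'b \<Rightarrow> 'a \<times> 'b"
  assume "d \<in> {d \<in> DerJ \<theta> \<phi> \<gamma>. centralizing \<eta>1 \<eta>2 d}"
  then have clin: "clinear d"
    and J: "\<And>a b. d (lau_mult \<theta> (a, b) (a, b)) = lau_mult \<phi> (d (a, b)) (a, b) + lau_mult \<gamma> (a, b) (d (a, b))"
    and C: "\<And>a b. lau_mult \<eta>1 (d (a, b)) (a, b) - lau_mult \<eta>2 (a, b) (d (a, b)) \<in> algebra_center \<times> algebra_center"
    by (auto simp: DerJ_def centralizing_def)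
  define S where "S a = fst (d (a, 0))" for a
  define P where "P a = snd (d (a, 0))" for a
  define T where "T b = fst (d (0, b))" for b
  define Q where "Q b = snd (d (0, b))" for b
  note d_simps = clinear_simps[OF clin]
  have d: "d (a, b) = (S a + T b, P a + Q b)" for a b
    using d_simps(1)[of "(a, 0)" "(0, b)"] by (simp add: S_def T_def P_def Q_def prod_eq_iff)
  have lin: "clinear S" "clinear P" "clinear T" "clinear Q"
  proof -
    have 1: "d (a + a', 0) = d (a, 0) + d (a', 0)" "d (0, b + b') = d (0, b) + d (0, b')" for a a' b b'
      using d_simps(1)[of "(a, 0)" "(a', 0)"] d_simps(1)[of "(0, b)" "(0, b')"] by simp_all
    have 2: "d (c *\<^sub>C a, 0) = c *\<^sub>C d (a, 0)" "d (0, c *\<^sub>C b) = c *\<^sub>C d (0, b)" for c a b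
      using d_simps(2)[of c "(a, 0)"] d_simps(2)[of c "(0, b)"] by (simp_all add: scaleC_prod_def)
    show "clinear S" "clinear P" "clinear T" "clinear Q"
      by (intro clinearI; simp add: S_def P_def T_def Q_def 1 2; simp add: scaleC_prod_def)+
  qed
  note S = clinear_simps[OF lin(1)] and P = clinear_simps[OF lin(2)]
    and T = clinear_simps[OF lin(3)] and Q = clinear_simps[OF lin(4)]
  have J1: "S (a * a) + \<theta> b *\<^sub>C S a + \<theta> b *\<^sub>C S a + T (b * b) =
      ((S a + T b) * a + \<phi> b *\<^sub>C (S a + T b) + \<phi> (P a + Q b) *\<^sub>C a) +
      (a * (S a + T b) + \<gamma> (P a + Q b) *\<^sub>C a + \<gamma> b *\<^sub>C (S a + T b))"
    and J2: "P (a * a) + \<theta> b *\<^sub>C P a + \<theta> b *\<^sub>C P a + Q (b * b) = (P a + Q b) * b + b * (P a + Q b)" for a b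
    using J[of a b] by (simp_all add: lau_mult_def d S P)
  have C1: "((S a + T b) * a + \<eta>1 b *\<^sub>C (S a + T b) + \<eta>1 (P a + Q b) *\<^sub>C a) -
      (a * (S a + T b) + \<eta>2 (P a + Q b) *\<^sub>C a + \<eta>2 b *\<^sub>C (S a + T b)) \<in> algebra_center"
    and C2: "(P a + Q b) * b - b * (P a + Q b) \<in> algebra_center" for a b
    using C[of a b] by (simp_all add: lau_mult_def d)
  have Q0: "Q b = 0" for b
  proof (rule centralizing_jordan_derivation_eq_0[OF assms(2) lin(4)])
    show "Q (b * b) = Q b * b + b * Q b" for b using J2[of 0 b] by (simp add: P)
    show "Q b * b - b * Q b \<in> algebra_center" for b using C2[of 0 b] by (simp add: P)
  qed
  have P0: "P a = 0" for a
  proof -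
    have sq: "P (a * a) = 0" for a using J2[of a 0] by (simp add: f_simps Q)
    have anti: "P (a * a' + a' * a) = 0" for a a'
      using sq[of "a + a'"] sq[of a] sq[of a'] by (simp add: distrib_left distrib_right P add.commute)
    \<comment> \<open>Since \<open>u * u = u\<close>, the Jordan product of \<open>u\<close> and
      \<open>u * a\<close> is twice \<open>u * a\<close>. Then \<open>anti\<close> at
      \<open>a\<close> and \<open>u\<close> passes from \<open>u * a\<close> to
      \<open>a\<close>.\<close>
    have "P (u * a) + P (u * a) = 0"
      using anti[of u "u * a"] u by (simp add: P flip: mult.assoc)
    then have "2 *\<^sub>R P (u * a) = 0" by (simp add: scaleR_2)
    then show ?thesis using anti[of a u] by (simp add: P u)
  qed
  have JS: "S (a * a) = S a * a + a * S a" for a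
    using J1[of a 0] by (simp add: f_simps P0 Q0 T)
  have Su: "S u = 0"
  proof -
    \<comment> \<open>\<open>JS\<close> at \<open>u\<close> reads
      \<open>S u = S u + u * S u\<close>. The centralizing condition enters once more:
      \<open>S u * u - u * S u\<close>, which is \<open>S u\<close>, is central, so
      \<open>S u * u = u * S u = 0\<close>.\<close>
    have "u * S u = 0" using JS[of u] by (simp add: u)
    moreover have "S u * u - u * S u \<in> algebra_center"
      using C1[of u 0] by (simp add: f_simps P0 Q0 T)
    ultimately have "S u * u = 0" using algebra_centerD[of "S u" u] by (simp add: u)
    then show ?thesis by (simp add: u)
  qed
  have JT: "T (b * b) = \<phi> b *\<^sub>C T b + \<gamma> b *\<^sub>C T b" for b
    using J1[of 0 b] by (simp add: f_simps P0 Q0 S)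
  have mixed: "\<theta> b *\<^sub>C S a + \<theta> b *\<^sub>C S a = T b * a + a * T b + \<phi> b *\<^sub>C S a + \<gamma> b *\<^sub>C S a" for a b
    using J1[of a b] by (simp add: f_simps P0 Q0 JS JT scaleC_add_right algebra_simps)
  have T0: "T b = 0" for b
  proof -
    \<comment> \<open>Evaluated at \<open>u\<close>, where \<open>S\<close> vanishes; a further
      multiplication by \<open>u\<close> doubles \<open>u * T b\<close>.\<close>
    have Tu: "T b + u * T b = 0" using mixed[of b u] by (simp add: Su u)
    then have "u * (T b + u * T b) = 0" by simp
    then have "u * T b + u * T b = 0" using u[of u] by (simp add: distrib_left flip: mult.assoc)
    then have "2 *\<^sub>R (u * T b) = 0" by (simp add: scaleR_2)
    then show ?thesis using Tu by simp
  qed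
  obtain b where b: "\<theta> b + \<theta> b - \<phi> b - \<gamma> b \<noteq> 0"
  proof (rule ccontr)
    assume "\<not> thesis"
    then have eq: "\<theta> b + \<theta> b = \<phi> b + \<gamma> b" for b using that by (metis diff_diff_eq right_minus_eq)
    have "\<theta> b = \<phi> b" for b
    proof -
      \<comment> \<open>The parallelogram law, with squares of values read as values at
        \<open>b * b\<close>: under \<open>eq\<close> the right side becomes
        \<open>4 * \<theta> (b * b) - 4 * (\<theta> b * \<theta> b)\<close>.\<close>
      have "(\<phi> b - \<gamma> b) * (\<phi> b - \<gamma> b) =
          2 * (\<phi> (b * b) + \<gamma> (b * b)) - (\<phi> b + \<gamma> b) * (\<phi> b + \<gamma> b)"
        by (simp add: mlf[THEN mult_linear_functional_simps(6)] algebra_simps)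
      also have "\<dots> = 2 * (\<theta> (b * b) + \<theta> (b * b)) - (\<theta> b + \<theta> b) * (\<theta> b + \<theta> b)"
        by (simp only: eq)
      also have "\<dots> = 0"
        by (simp add: mlf[THEN mult_linear_functional_simps(6)] algebra_simps)
      finally have "\<phi> b = \<gamma> b" by simp
      then show ?thesis using eq[of b] by simp
    qed
    then show False using assms(8) by blast
  qed
  have "S a = 0" for a
  proof -
    have "(\<theta> b + \<theta> b - \<phi> b - \<gamma> b) *\<^sub>C S a = 0"
      using mixed[of b a]
      by (simp only: T0 scaleC_add_left complex_vector.scale_left_diff_distrib) simp
    then show ?thesis using b by simp
  qed
  then have "d = (\<lambda>_. 0)" by (auto simp: fun_eq_iff d P0 Q0 T0 zero_prod_def)
  then show "d \<in> {\<lambda>_. 0}" by simp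
next
  have mlf: "mult_linear_functional \<phi>" "mult_linear_functional \<gamma>" "mult_linear_functional \<eta>1" "mult_linear_functional \<eta>2"
    using assms by (simp_all add: nonzero_mult_linear_functional_def)
  fix d :: "'a \<times> 'b \<Rightarrow> 'a \<times> 'b" assume "d \<in> {\<lambda>_. 0}"
  then show "d \<in> {d \<in> DerJ \<theta> \<phi> \<gamma>. centralizing \<eta>1 \<eta>2 d}"
    by (auto simp: DerJ_def centralizing_def lau_mult_def algebra_center_def zero_prod_def
        scaleC_prod_def
        mlf[THEN mult_linear_functional_simps(3)] intro!: clinearI)
qed

end
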